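(* Let $\Gamma$ be a $\mathbb Z^d$-periodic graph, $d\ge 2$, and let $H=\Delta+Q$ be the Schrödinger operator on $\ell^2(V)$ with a real $\mathbb Z^d$-periodic potential $Q$ (notation as in the context). Then: (i) The smallest eigenvalue $\lambda_1(0)$ of the fiber operator $H(0)$ is simple and has an eigenvector $\psi\in\ell^2(V_* )$ all of whose components are positive. (ii) The first spectral band $\sigma_1(H)=[\lambda_1^-,\lambda_1^+]$ of $H$ is nondegenerate, i.e. $\lambda_1^-<\lambda_1^+$, and $$c_0^{-2}\,|\sigma_1(\Delta)|\le |\sigma_1(H)|\le c_0^{2}\,|\sigma_1(\Delta)|,\qquad c_0=\frac{\psi_+}{\psi_-},\quad \psi_-=\min_{v\in V_*}\frac{\psi(v)}{\sqrt{\varkappa_v}},\quad \psi_+=\max_{v\in V_*}\frac{\psi(v)}{\sqrt{\varkappa_v}},$$ where $\sigma_1(\Delta)$ is the first spectral band of the Laplacian $\Delta$ and $|\cdot|$ denotes length. (iii) The effective mass tensor $m$ of $H$ at the bottom of the spectrum satisfies (in the sense of quadratic forms on $\mathbb R^d$) $$c_0^{-2}\,m_0\le m\le c_0^{2}\,m_0,$$ where $m_0$ is the effective mass tensor of the Laplacian $\Delta$ at the bottom of its spectrum. Here, writing $\lambda_1(\vartheta)=\lambda_1(0)+\frac12\sum_{i,j=1}^d M_{ij}\vartheta_i\vartheta_j+O(|\vartheta|^3)$ with $M_{ij}=\frac{\partial^2\lambda_1(0)}{\partial\vartheta_i\partial\vartheta_j}$, the effective mass tensor is $m=M^{-1}$,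 $M=\{M_{ij}\}$; $m_0$ is defined in the same way from the first band function $\lambda^0_1(\vartheta)$ of $\Delta(\vartheta)$.
   Context: Setting. $\Gamma=(V,\mathcal E)$ is a connected infinite graph, possibly with loops and multiple edges, on which $\mathbb Z^d$ ($d\ge2$) acts freely by graph automorphisms (the action of $m\in\mathbb Z^d$ on $v\in V$ is written $v+m$), every vertex has finite degree, and the quotient (fundamental) graph $\Gamma_*=\Gamma/\mathbb Z^d=(V_*,\mathcal E_* )$ is finite; $\nu=\#V_*$. Each undirected edge is regarded as two oppositely oriented edges; $\mathcal A$ denotes the set of oriented edges of $\Gamma$ (an edge $\mathbf e=(u,v)$ goes from $u$ to $v$), and $\mathcal A_*=\mathcal A/\mathbb Z^d$. The degree $\varkappa_v$ of a vertex $v$ is the number of oriented edges starting at $v$ (it is $\mathbb Z^d$-invariant, hence defined for $v\in V_*$). The normalized Laplacian on $\ell^2(V)$ is $(\Delta f)(v)=f(v)-\sum_{(v,u)\in\mathcal A}\frac{1}{\sqrt{\varkappa_v\varkappa_u}}f(u)$, and $H=\Delta+Q$, where $Q:V\to\mathbb R$ satisfies $Q(v+m)=Q(v)$ (so $Q$ is also a function on $V_*$). Edge indices. Fix a subtree $T$ of $\Gamma$ whose vertex set $V_0$ consists of $\nu$ pairwise non-$\mathbb Z^d$-equivalent vertices (such trees exist). Every $v\in V$ is uniquely $v=v_0+[v]$ with $v_0\in V_0$, $[v]\in\mathbb Z^d$. The index of $\mathbf e=(u,v)\in\mathcal A$ is $\tau(\mathbf e)=[v]-[u]\in\mathbb Z^d$;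 it is invariant under the $\mathbb Z^d$-action, so it defines $\tau$ on $\mathcal A_*$. Fiber operators and bands. For $\vartheta\in\mathbb T^d=\mathbb R^d/(2\pi\mathbb Z)^d$, the operators on $\ell^2(V_* )\cong\mathbb C^\nu$ are $(\Delta(\vartheta)f)(v)=f(v)-\sum_{\mathbf e=(v,u)\in\mathcal A_*}\frac{e^{i\langle\tau(\mathbf e),\vartheta\rangle}}{\sqrt{\varkappa_v\varkappa_u}}f(u)$ and $H(\vartheta)=\Delta(\vartheta)+Q$; $H$ is unitarily equivalent to $\frac{1}{(2\pi)^d}\int^{\oplus}_{\mathbb T^d}H(\vartheta)\,d\vartheta$. Let $\lambda_1(\vartheta)\le\dots\le\lambda_\nu(\vartheta)$ be the eigenvalues of $H(\vartheta)$ (with multiplicity) and $\sigma_n(H)=[\lambda_n^-,\lambda_n^+]=\lambda_n(\mathbb T^d)$ the spectral bands, so $\sigma(H)=\bigcup_{n=1}^\nu\sigma_n(H)$. Analogously $\lambda^0_n(\vartheta)$ are the eigenvalues of $\Delta(\vartheta)$ and $\sigma_n(\Delta)=[\lambda_n^{0-},\lambda_n^{0+}]=\lambda^0_n(\mathbb T^d)$. A band is nondegenerate if it is not a single point. *)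

theory Defs
  imports "HOL-Analysis.Analysis" "HOL-Library.Landau_Symbols"
begin

text \<open>A graph with loops and multiple edges: vertices are the elements of type 'v,
  oriented edges are the elements of type 'a; every oriented edge e goes from src e to tgt e,
  and rv e is the oppositely oriented copy of the same undirected edge.
  The group Z^d (here int^'d, with d = CARD('d)) acts on vertices by actv and on oriented
  edges by acte; actv m v is written v + m in the paper.\<close>

definition periodic_graph ::
  "('a \<Rightarrow> 'v) \<Rightarrow> ('a \<Rightarrow> 'v) \<Rightarrow> ('a \<Rightarrow> 'a) \<Rightarrow>
   (int^'d \<Rightarrow> 'v \<Rightarrow> 'v) \<Rightarrow> (int^'d \<Rightarrow> 'a \<Rightarrow> 'a) \<Rightarrow> bool" where
  "periodic_graph src tgt rv actv acte \<longleftrightarrow>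
     \<comment> \<open>undirected edges as pairs of opposite oriented edges\<close>
     (\<forall>e. rv (rv e) = e \<and> rv e \<noteq> e \<and> src (rv e) = tgt e \<and> tgt (rv e) = src e) \<and>
     \<comment> \<open>group actions of Z^d\<close>
     (\<forall>v. actv 0 v = v) \<and> (\<forall>m n v. actv (m + n) v = actv m (actv n v)) \<and>
     (\<forall>e. acte 0 e = e) \<and> (\<forall>m n e. acte (m + n) e = acte m (acte n e)) \<and>
     \<comment> \<open>acting by graph automorphisms\<close>
     (\<forall>m e. src (acte m e) = actv m (src e) \<and> tgt (acte m e) = actv m (tgt e)
            \<and> rv (acte m e) = acte m (rv e)) \<and>
     \<comment> \<open>the action is free\<close>
     (\<forall>m v. actv m v = v \<longrightarrow> m = 0) \<and>
     \<comment> \<open>every vertex has finite degree\<close>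
     (\<forall>v. finite {e. src e = v}) \<and>
     \<comment> \<open>the quotient graph is finite (finitely many vertex orbits)\<close>
     finite (range (\<lambda>v. range (\<lambda>m. actv m v))) \<and>
     \<comment> \<open>the graph is connected (and nonempty)\<close>
     (\<exists>v::'v. True) \<and>
     (\<forall>u v. (\<lambda>x y. \<exists>e. src e = x \<and> tgt e = y)\<^sup>*\<^sup>* u v)"

text \<open>V0 is the vertex set of a subtree T of the graph consisting of one representative
  of every Z^d-orbit. (A subtree with vertex set V0 exists iff the subgraph induced on V0
  is connected, since then it has a spanning tree.)\<close>

definition tree_representatives ::
  "('a \<Rightarrow> 'v) \<Rightarrow> ('a \<Rightarrow> 'v) \<Rightarrow> (int^'d \<Rightarrow> 'v \<Rightarrow> 'v) \<Rightarrow> 'v set \<Rightarrow> bool" where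
  "tree_representatives src tgt actv V0 \<longleftrightarrow>
     (\<forall>v. \<exists>!p. fst p \<in> V0 \<and> v = actv (snd p) (fst p)) \<and>
     (\<forall>u\<in>V0. \<forall>w\<in>V0.
        (\<lambda>x y. x \<in> V0 \<and> y \<in> V0 \<and> (\<exists>e. src e = x \<and> tgt e = y))\<^sup>*\<^sup>* u w)"

definition base :: "(int^'d \<Rightarrow> 'v \<Rightarrow> 'v) \<Rightarrow> 'v set \<Rightarrow> 'v \<Rightarrow> 'v" where
  "base actv V0 v = (THE v0. v0 \<in> V0 \<and> (\<exists>m. v = actv m v0))"

definition coord :: "(int^'d \<Rightarrow> 'v \<Rightarrow> 'v) \<Rightarrow> 'v set \<Rightarrow> 'v \<Rightarrow> int^'d" where
  "coord actv V0 v = (THE m. \<exists>v0\<in>V0. v = actv m v0)"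

definition edge_index ::
  "('a \<Rightarrow> 'v) \<Rightarrow> ('a \<Rightarrow> 'v) \<Rightarrow> (int^'d \<Rightarrow> 'v \<Rightarrow> 'v) \<Rightarrow> 'v set \<Rightarrow> 'a \<Rightarrow> int^'d" where
  "edge_index src tgt actv V0 e = coord actv V0 (tgt e) - coord actv V0 (src e)"

definition degree :: "('a \<Rightarrow> 'v) \<Rightarrow> 'v \<Rightarrow> real" where
  "degree src v = real (card {e. src e = v})"

definition iprod :: "int^'d \<Rightarrow> real^'d \<Rightarrow> real" where
  "iprod m \<theta> = (\<Sum>i\<in>UNIV. real_of_int (m $ i) * \<theta> $ i)"

text \<open>Fiber operator H(theta) = Delta(theta) + Q acting on l^2(V_*), where V_* is identified
  with V0 (vectors are functions 'v => complex, only their values on V0 matter).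
  The oriented edges of the quotient graph starting at the class of v in V0 correspond
  bijectively to the oriented edges of the graph starting at v.\<close>
definition fiber_op ::
  "('a \<Rightarrow> 'v) \<Rightarrow> ('a \<Rightarrow> 'v) \<Rightarrow> (int^'d \<Rightarrow> 'v \<Rightarrow> 'v) \<Rightarrow> 'v set \<Rightarrow> ('v \<Rightarrow> real) \<Rightarrow>
   real^'d \<Rightarrow> ('v \<Rightarrow> complex) \<Rightarrow> 'v \<Rightarrow> complex" where
  "fiber_op src tgt actv V0 Q \<theta> f v =
     f v - (\<Sum>e\<in>{e. src e = v}.
              cis (iprod (edge_index src tgt actv V0 e) \<theta>)
              / complex_of_real (sqrt (degree src v * degree src (tgt e)))
              * f (base actv V0 (tgt e)))
     + complex_of_real (Q v) * f v"

definition fvec :: "'v set \<Rightarrow> ('v \<Rightarrow> complex) \<Rightarrow> bool" where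
  "fvec V0 f \<longleftrightarrow> (\<forall>v. v \<notin> V0 \<longrightarrow> f v = 0)"

definition is_eigenvector ::
  "('a \<Rightarrow> 'v) \<Rightarrow> ('a \<Rightarrow> 'v) \<Rightarrow> (int^'d \<Rightarrow> 'v \<Rightarrow> 'v) \<Rightarrow> 'v set \<Rightarrow> ('v \<Rightarrow> real) \<Rightarrow>
   real^'d \<Rightarrow> real \<Rightarrow> ('v \<Rightarrow> complex) \<Rightarrow> bool" where
  "is_eigenvector src tgt actv V0 Q \<theta> lam f \<longleftrightarrow>
     fvec V0 f \<and> (\<exists>v. f v \<noteq> 0) \<and>
     (\<forall>v\<in>V0. fiber_op src tgt actv V0 Q \<theta> f v = complex_of_real lam * f v)"

definition fiber_eigenvalues ::
  "('a \<Rightarrow> 'v) \<Rightarrow> ('a \<Rightarrow> 'v) \<Rightarrow> (int^'d \<Rightarrow> 'v \<Rightarrow> 'v) \<Rightarrow> 'v set \<Rightarrow> ('v \<Rightarrow> real) \<Rightarrow>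
   real^'d \<Rightarrow> real set" where
  "fiber_eigenvalues src tgt actv V0 Q \<theta> =
     {lam. \<exists>f. is_eigenvector src tgt actv V0 Q \<theta> lam f}"

definition lambda1 ::
  "('a \<Rightarrow> 'v) \<Rightarrow> ('a \<Rightarrow> 'v) \<Rightarrow> (int^'d \<Rightarrow> 'v \<Rightarrow> 'v) \<Rightarrow> 'v set \<Rightarrow> ('v \<Rightarrow> real) \<Rightarrow>
   real^'d \<Rightarrow> real" where
  "lambda1 src tgt actv V0 Q \<theta> = Min (fiber_eigenvalues src tgt actv V0 Q \<theta>)"

text \<open>first spectral band sigma_1 = lambda_1(T^d) (lambda_1 is 2 pi-periodic, so
  taking theta over all of R^d gives the same image)\<close>
definition band1 ::
  "('a \<Rightarrow> 'v) \<Rightarrow> ('a \<Rightarrow> 'v) \<Rightarrow> (int^'d \<Rightarrow> 'v \<Rightarrow> 'v) \<Rightarrow> 'v set \<Rightarrow> ('v \<Rightarrow> real) \<Rightarrow> real set" where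
  "band1 src tgt actv V0 Q = range (lambda1 src tgt actv V0 Q)"

definition band_length :: "real set \<Rightarrow> real" where
  "band_length S = Sup S - Inf S"

text \<open>lambda(theta) = lambda(0) + 1/2 sum M_ij theta_i theta_j + O(|theta|^3), M symmetric
  (this determines M uniquely; it is the Hessian of lambda at 0)\<close>
definition second_order_expansion :: "(real^'d \<Rightarrow> real) \<Rightarrow> real^'d^'d \<Rightarrow> bool" where
  "second_order_expansion lam M \<longleftrightarrow>
     transpose M = M \<and>
     (\<lambda>\<theta>. lam \<theta> - lam 0 - (1/2) * (\<Sum>i\<in>UNIV. \<Sum>j\<in>UNIV. M $ i $ j * \<theta> $ i * \<theta> $ j))
       \<in> O[at 0](\<lambda>\<theta>. norm \<theta> ^ 3)"

definition effective_mass :: "(real^'d \<Rightarrow> real) \<Rightarrow> real^'d^'d \<Rightarrow> bool" where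
  "effective_mass lam m \<longleftrightarrow>
     (\<exists>M. second_order_expansion lam M \<and> invertible M \<and> m = matrix_inv M)"

definition qf_le :: "real^'d^'d \<Rightarrow> real^'d^'d \<Rightarrow> bool" where
  "qf_le A B \<longleftrightarrow> (\<forall>x. x \<bullet> (A *v x) \<le> x \<bullet> (B *v x))"

end

theory Submission
  imports Defs
begin

text \<open>Write a vector as \<open>f = \<psi> g\<close> with the positive ground state \<open>\<psi>\<close> of \<open>H(0)\<close>. Then
  \<open>\<langle>(H(\<theta>) - \<lambda>\<^sub>1(0)) f, f\<rangle>\<close> is half the sum over the edges \<open>e = (v,u)\<close> of the quotient of
  \<open>a(e) |g(v) - exp(i\<langle>\<tau>(e),\<theta>\<rangle>) g(u)|\<^sup>2\<close>, where \<open>a(e) = \<psi>(v) \<psi>(u) / sqrt(\<kappa>(v) \<kappa>(u))\<close>. For the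
  Laplacian, \<open>\<psi> = sqrt \<kappa>\<close> and \<open>a = 1\<close>, so both this form and the weighted norm of \<open>g\<close> are
  comparable to those of the Laplacian with constants \<open>\<psi>\<^sub>-\<^sup>2\<close> and \<open>\<psi>\<^sub>+\<^sup>2\<close>; the minimax principle compares
  the band functions.

  For the effective mass, testing with \<open>g = exp(i h)\<close> bounds \<open>\<lambda>\<^sub>1(\<theta>) - \<lambda>\<^sub>1(0)\<close> from above by the
  minimum over real \<open>h\<close> of half the sum of \<open>a(e) (\<langle>\<tau>(e),\<theta>\<rangle> + h(u) - h(v))\<^sup>2\<close>, divided by the squared
  norm of \<open>\<psi>\<close>. This minimum is a quadratic form in \<open>\<theta>\<close>. Conversely the minimizing \<open>g\<close> is constant
  up to \<open>O(|\<theta>|)\<close>, and its imaginary part is an admissible \<open>h\<close> up to an error \<open>O(|\<theta>|\<^sup>3)\<close> in the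
  energy. So this form is the Hessian, and it inherits the comparison, which matrix inversion
  reverses.\<close>

section \<open>Preliminaries: compact sets of functions and a first-order condition\<close>

text \<open>Tychonoff: functions carry the product topology. This plays the role of Heine-Borel for
  functions on the possibly infinite type \<open>'v\<close>.\<close>

lemma compact_function_box:
  fixes B :: "'v \<Rightarrow> 'b::topological_space set"
  assumes "\<And>v. compact (B v)"
  shows "compact {f. \<forall>v. f v \<in> B v}"
proof -
  have "compactin (product_topology (\<lambda>_. euclidean) UNIV) (PiE UNIV B)"
    using assms by (simp add: compactin_PiE)
  moreover have "PiE UNIV B = {f. \<forall>v. f v \<in> B v}"
    by (auto simp: PiE_def Pi_def)
  ultimately show ?thesis
    by (simp add: euclidean_product_topology)
qed

text \<open>The first-order condition at a minimum: near \<open>t = 0\<close> the linear term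
  dominates. The constant \<open>k\<close> exceeds \<open>b\<close> and is positive whatever the
  sign of \<open>b\<close>, so \<open>- a / k\<close> is a legitimate test point.\<close>

lemma linear_term_zero_of_nonneg:
  fixes a b :: real
  assumes "\<And>t. 0 \<le> 2 * t * a + t\<^sup>2 * b"
  shows "a = 0"
proof (rule ccontr)
  assume "a \<noteq> 0"
  define k where "k = \<bar>b\<bar> + 1"
  have k: "k > 0" "b \<le> k" by (auto simp: k_def)
  have "0 \<le> 2 * (- a / k) * a + (- a / k)\<^sup>2 * b" by (rule assms)
  also have "\<dots> \<le> 2 * (- a / k) * a + (- a / k)\<^sup>2 * k"
    using k by (intro add_left_mono mult_left_mono) auto
  also have "\<dots> = - (a\<^sup>2 / k)"
    using k by (simp add: power2_eq_square field_simps)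
  also have "\<dots> < 0" using k \<open>a \<noteq> 0\<close> by simp
  finally show False by simp
qed

section \<open>Hermitian kernels on a finite set\<close>

locale hermitian_kernel =
  fixes V :: "'v set" and K :: "'v \<Rightarrow> 'v \<Rightarrow> complex"
  assumes finite_V: "finite V" and V_nonempty: "V \<noteq> {}"
    and hermitian: "\<lbrakk>u \<in> V; v \<in> V\<rbrakk> \<Longrightarrow> K u v = cnj (K v u)"
begin

definition apply_kernel :: "('v \<Rightarrow> complex) \<Rightarrow> 'v \<Rightarrow> complex" where
  "apply_kernel f v = (\<Sum>u\<in>V. K v u * f u)"

definition eigen :: "real \<Rightarrow> ('v \<Rightarrow> complex) \<Rightarrow> bool" where
  "eigen \<mu> f \<longleftrightarrow> fvec V f \<and> (\<exists>v. f v \<noteq> 0) \<and>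
     (\<forall>v\<in>V. apply_kernel f v = complex_of_real \<mu> * f v)"

definition rayleigh :: "('v \<Rightarrow> complex) \<Rightarrow> real" where
  "rayleigh f = Re (\<Sum>v\<in>V. cnj (f v) * apply_kernel f v)"

definition norm2 :: "('v \<Rightarrow> complex) \<Rightarrow> real" where
  "norm2 f = (\<Sum>v\<in>V. (cmod (f v))\<^sup>2)"

lemma norm2_nonneg: "norm2 f \<ge> 0"
  by (simp add: norm2_def sum_nonneg)

lemma norm2_pos: "\<lbrakk>fvec V f; f v \<noteq> 0\<rbrakk> \<Longrightarrow> norm2 f > 0"
  unfolding norm2_def fvec_def using finite_V
  by (intro sum_pos2[where i = v]) auto

lemma of_real_norm2: "complex_of_real (norm2 f) = (\<Sum>v\<in>V. cnj (f v) * f v)"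
  unfolding norm2_def of_real_sum
  by (rule sum.cong) (simp_all add: complex_norm_square mult.commute del: of_real_power)

lemma apply_kernel_selfadjoint:
  "(\<Sum>v\<in>V. cnj (g v) * apply_kernel f v) = (\<Sum>v\<in>V. cnj (apply_kernel g v) * f v)"
proof -
  have "(\<Sum>v\<in>V. cnj (g v) * apply_kernel f v) = (\<Sum>v\<in>V. \<Sum>u\<in>V. cnj (g v) * (K v u * f u))"
    by (simp add: apply_kernel_def sum_distrib_left)
  also have "\<dots> = (\<Sum>u\<in>V. \<Sum>v\<in>V. cnj (g v) * (K v u * f u))"
    by (rule sum.swap)
  also have "\<dots> = (\<Sum>u\<in>V. \<Sum>v\<in>V. cnj (K u v * g v) * f u)"
    by (intro sum.cong refl) (simp add: hermitian[symmetric] mult_ac)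
  also have "\<dots> = (\<Sum>v\<in>V. cnj (apply_kernel g v) * f v)"
    by (simp add: apply_kernel_def sum_distrib_right)
  finally show ?thesis .
qed

lemma rayleigh_eigen:
  assumes "eigen \<mu> f"
  shows "rayleigh f = \<mu> * norm2 f"
proof -
  have "(\<Sum>v\<in>V. cnj (f v) * apply_kernel f v) = (\<Sum>v\<in>V. complex_of_real \<mu> * (cnj (f v) * f v))"
    using assms by (intro sum.cong refl) (simp add: eigen_def mult_ac)
  also have "\<dots> = complex_of_real (\<mu> * norm2 f)"
    by (simp add: of_real_norm2 sum_distrib_left)
  finally show ?thesis by (simp add: rayleigh_def)
qed

lemma eigen_orthogonal:
  assumes "eigen \<mu> f" "eigen \<nu> g" "\<mu> \<noteq> \<nu>"
  shows "(\<Sum>v\<in>V. cnj (g v) * f v) = 0"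
proof -
  have "complex_of_real \<mu> * (\<Sum>v\<in>V. cnj (g v) * f v) = (\<Sum>v\<in>V. cnj (g v) * apply_kernel f v)"
    using assms(1) unfolding sum_distrib_left by (intro sum.cong refl) (simp add: eigen_def mult_ac)
  also have "\<dots> = (\<Sum>v\<in>V. cnj (apply_kernel g v) * f v)"
    by (rule apply_kernel_selfadjoint)
  also have "\<dots> = complex_of_real \<nu> * (\<Sum>v\<in>V. cnj (g v) * f v)"
    using assms(2) unfolding sum_distrib_left by (intro sum.cong refl) (simp add: eigen_def mult_ac)
  finally show ?thesis using assms(3) by simp
qed

lemma norm2_scale: "norm2 (\<lambda>v. c * f v) = (cmod c)\<^sup>2 * norm2 f"
  by (simp add: norm2_def norm_mult power_mult_distrib sum_distrib_left)

lemma eigen_scale: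
  assumes "eigen \<mu> f" "c \<noteq> 0"
  shows "eigen \<mu> (\<lambda>v. c * f v)"
proof -
  have "apply_kernel (\<lambda>v. c * f v) v = c * apply_kernel f v" for v
    by (simp add: apply_kernel_def sum_distrib_left mult_ac)
  then show ?thesis using assms by (auto simp: eigen_def fvec_def mult_ac)
qed

lemma eigen_normalized:
  assumes "eigen \<mu> f"
  shows "\<exists>g. eigen \<mu> g \<and> norm2 g = 1"
proof -
  have p: "norm2 f > 0" using assms norm2_pos by (auto simp: eigen_def)
  define c where "c = complex_of_real (1 / sqrt (norm2 f))"
  have "(cmod c)\<^sup>2 * norm2 f = 1" using p by (simp add: c_def norm_divide power_divide)
  moreover have "c \<noteq> 0" using p by (simp add: c_def)
  ultimately have "eigen \<mu> (\<lambda>v. c * f v) \<and> norm2 (\<lambda>v. c * f v) = 1"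
    using eigen_scale[OF assms] by (simp add: norm2_scale)
  then show ?thesis by blast
qed

text \<open>Bessel's inequality for the point mass \<open>d\<close> at \<open>v\<close>:
  \<open>P\<close> is its projection to the span of the family, and the squared norm of
  \<open>d - P\<close> is \<open>1 - b\<close>.\<close>

lemma bessel_delta:
  assumes S: "finite S" and v: "v \<in> V"
    and ortho: "\<And>i j. \<lbrakk>i \<in> S; j \<in> S\<rbrakk> \<Longrightarrow> (\<Sum>u\<in>V. cnj (F j u) * F i u) = (if i = j then 1 else 0)"
  shows "(\<Sum>i\<in>S. (cmod (F i v))\<^sup>2) \<le> 1"
proof -
  define P where "P u = (\<Sum>i\<in>S. cnj (F i v) * F i u)" for u
  define d where "d u = (if u = v then 1 else 0 :: complex)" for u
  define b where "b = (\<Sum>i\<in>S. (cmod (F i v))\<^sup>2)"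
  have Pv: "P v = of_real b"
    unfolding P_def b_def of_real_sum
    by (rule sum.cong) (simp_all add: complex_norm_square mult.commute del: of_real_power)
  have dP: "(\<Sum>u\<in>V. cnj (d u) * P u) = of_real b" "(\<Sum>u\<in>V. cnj (P u) * d u) = of_real b"
           "(\<Sum>u\<in>V. cnj (d u) * d u) = 1"
    using finite_V v by (auto simp: d_def Pv if_distrib if_distribR sum.delta cong: if_cong)
  have PP: "(\<Sum>u\<in>V. cnj (P u) * P u) = of_real b"
  proof -
    have "(\<Sum>u\<in>V. cnj (P u) * P u) =
        (\<Sum>u\<in>V. \<Sum>j\<in>S. \<Sum>i\<in>S. (F j v * cnj (F i v)) * (cnj (F j u) * F i u))"
      unfolding P_def cnj_sum sum_product by (intro sum.cong refl) (simp add: mult_ac)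
    also have "\<dots> = (\<Sum>j\<in>S. \<Sum>u\<in>V. \<Sum>i\<in>S. (F j v * cnj (F i v)) * (cnj (F j u) * F i u))"
      by (rule sum.swap)
    also have "\<dots> = (\<Sum>j\<in>S. \<Sum>i\<in>S. \<Sum>u\<in>V. (F j v * cnj (F i v)) * (cnj (F j u) * F i u))"
      by (intro sum.cong refl sum.swap)
    also have "\<dots> = (\<Sum>j\<in>S. \<Sum>i\<in>S. (F j v * cnj (F i v)) * (if i = j then 1 else 0))"
      by (intro sum.cong refl) (simp add: ortho sum_distrib_left[symmetric])
    also have "\<dots> = (\<Sum>j\<in>S. F j v * cnj (F j v))"
      using S by (simp add: if_distrib sum.delta cong: if_cong)
    also have "\<dots> = of_real b"
      by (simp add: b_def complex_norm_square del: of_real_power)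
    finally show ?thesis .
  qed
  have "complex_of_real (norm2 (\<lambda>u. d u - P u)) = 1 - of_real b"
    unfolding of_real_norm2 using dP PP
    by (simp add: algebra_simps sum.distrib sum_subtractf)
  then have "norm2 (\<lambda>u. d u - P u) = 1 - b"
    by (metis of_real_1 of_real_diff of_real_eq_iff)
  then show ?thesis using norm2_nonneg[of "\<lambda>u. d u - P u"] by (simp add: b_def)
qed

text \<open>Normalized eigenvectors to distinct eigenvalues are orthonormal, so summing Bessel's
  inequality over \<open>V\<close> bounds their number by \<open>card V\<close>. Finiteness is what
  gives \<open>Min\<close> of the spectrum its meaning.\<close>

lemma finite_eigenvalues: "finite {\<mu>. \<exists>f. eigen \<mu> f}"
proof -
  obtain F where F: "\<And>\<mu>. \<exists>f. eigen \<mu> f \<Longrightarrow> eigen \<mu> (F \<mu>) \<and> norm2 (F \<mu>) = 1"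
    using eigen_normalized by metis
  have "card S \<le> card V" if S: "S \<subseteq> {\<mu>. \<exists>f. eigen \<mu> f}" "finite S" for S
  proof -
    have o: "(\<Sum>u\<in>V. cnj (F j u) * F i u) = (if i = j then 1 else 0)" if "i \<in> S" "j \<in> S" for i j
    proof (cases "i = j")
      case True
      have "norm2 (F j) = 1" using F[of j] that S by auto
      then show ?thesis using True of_real_norm2[of "F j"] by simp
    next
      case False
      have "eigen i (F i)" "eigen j (F j)" using that S F by auto
      from eigen_orthogonal[OF this False] show ?thesis using False by simp
    qed
    have "real (card S) = (\<Sum>i\<in>S. norm2 (F i))"
      using S F by (simp add: subset_eq)
    also have "\<dots> = (\<Sum>v\<in>V. \<Sum>i\<in>S. (cmod (F i v))\<^sup>2)"
      unfolding norm2_def by (rule sum.swap)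
    also have "\<dots> \<le> (\<Sum>v\<in>V. 1)"
      by (rule sum_mono) (rule bessel_delta[OF S(2) _ o])
    finally show ?thesis by simp
  qed
  then show ?thesis using finite_if_finite_subsets_card_bdd by blast
qed

text \<open>Coordinates outside \<open>V\<close> are pinned to 0 and those in \<open>V\<close> lie
  in the unit disc, so the sphere is a closed subset of a compact box.\<close>

lemma compact_sphere: "compact {f. fvec V f \<and> norm2 f = 1}"
proof -
  define B where "B v = (if v \<in> V then cball 0 1 else {0::complex})" for v
  have c: "compact {f. \<forall>v. f v \<in> B v}"
    by (rule compact_function_box) (simp add: B_def)
  have "continuous_on UNIV norm2"
    unfolding norm2_def
    by (intro continuous_intros continuous_on_product_coordinates)
  then have "closed (norm2 -` {1})"
    by (simp add: closed_vimage)
  then have "compact ({f. \<forall>v. f v \<in> B v} \<inter> norm2 -` {1})"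
    using c by (rule compact_Int_closed[rotated])
  also have "{f. \<forall>v. f v \<in> B v} \<inter> norm2 -` {1} = {f. fvec V f \<and> norm2 f = 1}"
  proof -
    have "cmod (f v) \<le> 1" if "norm2 f = 1" "v \<in> V" for f v
    proof -
      have "(cmod (f v))\<^sup>2 \<le> norm2 f"
        unfolding norm2_def using that finite_V by (intro member_le_sum) auto
      then show ?thesis using that by (simp add: power_le_one_iff abs_le_square_iff)
    qed
    then show ?thesis by (auto simp: B_def fvec_def split: if_splits)
  qed
  finally show ?thesis .
qed

lemma rayleigh_scale: "rayleigh (\<lambda>v. c * f v) = (cmod c)\<^sup>2 * rayleigh f"
proof -
  have "(\<Sum>v\<in>V. cnj (c * f v) * apply_kernel (\<lambda>v. c * f v) v) =
      (cnj c * c) * (\<Sum>v\<in>V. cnj (f v) * apply_kernel f v)"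
    by (simp add: apply_kernel_def sum_distrib_left mult_ac)
  also have "cnj c * c = of_real ((cmod c)\<^sup>2)"
    by (simp add: complex_norm_square mult.commute del: of_real_power)
  finally show ?thesis by (simp add: rayleigh_def del: of_real_power)
qed

lemma rayleigh_add:
  "rayleigh (\<lambda>v. f v + of_real t * g v) =
     rayleigh f + 2 * t * Re (\<Sum>v\<in>V. cnj (g v) * apply_kernel f v) + t\<^sup>2 * rayleigh g"
proof -
  define b where "b = (\<Sum>v\<in>V. cnj (g v) * apply_kernel f v)"
  have b': "(\<Sum>v\<in>V. cnj (f v) * apply_kernel g v) = cnj b"
    by (subst apply_kernel_selfadjoint) (simp add: b_def mult.commute)
  have a: "apply_kernel (\<lambda>v. f v + of_real t * g v) v =
      apply_kernel f v + of_real t * apply_kernel g v" for v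
    by (simp add: apply_kernel_def sum_distrib_left sum.distrib[symmetric] algebra_simps)
  have "(\<Sum>v\<in>V. cnj (f v + of_real t * g v) * apply_kernel (\<lambda>v. f v + of_real t * g v) v) =
      (\<Sum>v\<in>V. cnj (f v) * apply_kernel f v) + of_real t * cnj b + of_real t * b
       + of_real (t\<^sup>2) * (\<Sum>v\<in>V. cnj (g v) * apply_kernel g v)"
    unfolding a b'[symmetric] unfolding b_def sum_distrib_left sum.distrib[symmetric]
    by (intro sum.cong refl) (simp add: algebra_simps power2_eq_square)
  then show ?thesis by (simp add: rayleigh_def b_def del: of_real_power)
qed

lemma norm2_add:
  "norm2 (\<lambda>v. f v + of_real t * g v) =
     norm2 f + 2 * t * Re (\<Sum>v\<in>V. cnj (g v) * f v) + t\<^sup>2 * norm2 g"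
proof -
  have "(cmod (f v + of_real t * g v))\<^sup>2 =
     (cmod (f v))\<^sup>2 + 2 * t * Re (cnj (g v) * f v) + t\<^sup>2 * (cmod (g v))\<^sup>2" for v
    unfolding cmod_power2 by (simp add: power2_eq_square algebra_simps)
  then show ?thesis
    unfolding norm2_def Re_sum sum_distrib_left sum.distrib[symmetric] by (intro sum.cong refl)
qed

text \<open>Perturb \<open>f\<close> in the direction of its residual \<open>h\<close>. The linear
  coefficient of the perturbed form is the squared norm of \<open>h\<close>, which therefore
  vanishes.\<close>

lemma eigen_of_rayleigh_minimizer:
  assumes f: "fvec V f" "f z \<noteq> 0" and eq: "rayleigh f = \<mu> * norm2 f"
    and min: "\<And>g. \<mu> * norm2 g \<le> rayleigh g"
  shows "eigen \<mu> f"
proof -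
  define h where "h v = (if v \<in> V then apply_kernel f v - of_real \<mu> * f v else 0)" for v
  have h: "(\<Sum>v\<in>V. cnj (h v) * apply_kernel f v) - of_real \<mu> * (\<Sum>v\<in>V. cnj (h v) * f v) = of_real (norm2 h)"
    unfolding of_real_norm2 sum_distrib_left sum_subtractf[symmetric]
    by (intro sum.cong refl) (simp add: h_def algebra_simps)
  have h': "Re (\<Sum>v\<in>V. cnj (h v) * apply_kernel f v) - \<mu> * Re (\<Sum>v\<in>V. cnj (h v) * f v) = norm2 h"
    using arg_cong[OF h, of Re] by simp
  have "0 \<le> 2 * t * norm2 h + t\<^sup>2 * (rayleigh h - \<mu> * norm2 h)" for t
    using min[of "\<lambda>v. f v + of_real t * h v"]
    unfolding rayleigh_add norm2_add h'[symmetric] eq by (simp add: algebra_simps)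
  then have "norm2 h = 0" by (rule linear_term_zero_of_nonneg)
  moreover have "fvec V h" by (simp add: fvec_def h_def)
  ultimately have "h v = 0" for v using norm2_pos[of h v] by fastforce
  then have "apply_kernel f v = of_real \<mu> * f v" if "v \<in> V" for v
    using that h_def[of v] by (metis eq_iff_diff_eq_0)
  then show ?thesis using f by (auto simp: eigen_def)
qed

lemma ex_rayleigh_minimum: "\<exists>\<mu> f. eigen \<mu> f \<and> (\<forall>g. \<mu> * norm2 g \<le> rayleigh g)"
proof -
  obtain z where z: "z \<in> V" using V_nonempty by blast
  let ?S = "{f. fvec V f \<and> norm2 f = 1}"
  have "norm2 (\<lambda>v. if v = z then 1 else 0) = 1"
    using z finite_V
    by (simp add: norm2_def if_distrib[where f = cmod] if_distrib[where f = "\<lambda>x. x\<^sup>2"] sum.delta cong: if_cong)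
  then have "(\<lambda>v. if v = z then 1 else 0) \<in> ?S"
    using z by (auto simp: fvec_def)
  then have ne: "?S \<noteq> {}" by blast
  have "continuous_on ?S rayleigh"
    unfolding rayleigh_def apply_kernel_def
    by (intro continuous_intros continuous_on_subset[OF continuous_on_product_coordinates]) auto
  from continuous_attains_inf[OF compact_sphere ne this]
  obtain f where f: "fvec V f" "norm2 f = 1" and min: "\<And>g. \<lbrakk>fvec V g; norm2 g = 1\<rbrakk> \<Longrightarrow> rayleigh f \<le> rayleigh g"
    by auto
  have min': "rayleigh f * norm2 g \<le> rayleigh g" for g
  proof (cases "norm2 g = 0")
    case True
    then have "\<forall>v\<in>V. g v = 0"
      using finite_V by (simp add: norm2_def sum_nonneg_eq_0_iff)
    then show ?thesis using True by (simp add: rayleigh_def)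
  next
    case False
    then have p: "norm2 g > 0" using norm2_nonneg[of g] by simp
    define c where "c = complex_of_real (1 / sqrt (norm2 g))"
    have c: "(cmod c)\<^sup>2 = 1 / norm2 g" using p by (simp add: c_def norm_divide power_divide)
    \<comment> \<open>Both forms see only the values on \<open>V\<close>; \<open>k\<close> is
      \<open>g\<close> cut off outside, as membership in the sphere demands.\<close>
    define k where "k v = (if v \<in> V then g v else 0)" for v
    have k: "norm2 k = norm2 g" "rayleigh k = rayleigh g"
      by (simp_all add: norm2_def rayleigh_def apply_kernel_def k_def)
    have "fvec V (\<lambda>v. c * k v)" by (simp add: fvec_def k_def)
    then have "rayleigh f \<le> rayleigh (\<lambda>v. c * k v)"
      using p c k by (intro min) (auto simp: norm2_scale)
    then show ?thesis
      using p c k by (simp add: rayleigh_scale field_simps)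
  qed
  have "\<exists>z. f z \<noteq> 0"
  proof (rule ccontr)
    assume "\<nexists>z. f z \<noteq> 0"
    then have "norm2 f = 0" by (simp add: norm2_def)
    then show False using f(2) by simp
  qed
  then have "eigen (rayleigh f) f"
    using eigen_of_rayleigh_minimizer[OF f(1) _ _ min'] f(2) by auto
  then show ?thesis using min' by blast
qed

text \<open>The minimal Rayleigh quotient is an eigenvalue and lies below all others. This opens the
  lowest eigenvalue to estimates by trial functions.\<close>

lemma Min_eigenvalue:
  defines "L \<equiv> Min {\<mu>. \<exists>f. eigen \<mu> f}"
  shows "\<exists>f. eigen L f" and "L * norm2 g \<le> rayleigh g"
proof -
  obtain \<mu> f where f: "eigen \<mu> f" and min: "\<And>g. \<mu> * norm2 g \<le> rayleigh g"
    using ex_rayleigh_minimum by blast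
  have "\<mu> \<le> \<nu>" if "eigen \<nu> k" for \<nu> k
  proof -
    have "norm2 k > 0" using that norm2_pos by (auto simp: eigen_def)
    then show ?thesis using min[of k] rayleigh_eigen[OF that] by simp
  qed
  then have "L = \<mu>"
    unfolding L_def using f finite_eigenvalues by (intro Min_eqI) auto
  then show "\<exists>f. eigen L f" "L * norm2 g \<le> rayleigh g" using f min by auto
qed

end

section \<open>Magnetic operators on a finite graph\<close>

text \<open>The last argument is the total of \<open>\<tau>\<close> along the walk: it tells into
  which translate of the fundamental cell a lift to the covering graph leads.\<close>

inductive walk :: "'a set \<Rightarrow> ('a \<Rightarrow> 'v) \<Rightarrow> ('a \<Rightarrow> 'v) \<Rightarrow> ('a \<Rightarrow> int^'d) \<Rightarrow> 'v \<Rightarrow> 'v \<Rightarrow> int^'d \<Rightarrow> bool"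
  for E s t \<tau> where
  walk_refl: "walk E s t \<tau> u u 0"
| walk_step: "\<lbrakk>walk E s t \<tau> u v m; e \<in> E; s e = v\<rbrakk> \<Longrightarrow> walk E s t \<tau> u (t e) (m + \<tau> e)"

text \<open>The last assumption says that the periodic graph covering this finite graph is connected.\<close>

locale quotient_graph =
  fixes V :: "'v set" and E :: "'a set" and s t :: "'a \<Rightarrow> 'v" and opp :: "'a \<Rightarrow> 'a"
    and w :: "'a \<Rightarrow> real" and \<tau> :: "'a \<Rightarrow> int^'d"
  assumes finite_V: "finite V" and V_nonempty: "V \<noteq> {}" and finite_E: "finite E"
    and s_in: "e \<in> E \<Longrightarrow> s e \<in> V"
    and opp_in: "e \<in> E \<Longrightarrow> opp e \<in> E" and opp_opp: "e \<in> E \<Longrightarrow> opp (opp e) = e"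
    and s_opp: "e \<in> E \<Longrightarrow> s (opp e) = t e"
    and w_pos: "e \<in> E \<Longrightarrow> w e > 0" and w_opp: "e \<in> E \<Longrightarrow> w (opp e) = w e"
    and \<tau>_opp: "e \<in> E \<Longrightarrow> \<tau> (opp e) = - \<tau> e"
    and walks: "\<lbrakk>u \<in> V; v \<in> V\<rbrakk> \<Longrightarrow> walk E s t \<tau> u v m"
begin

lemma t_opp: "e \<in> E \<Longrightarrow> t (opp e) = s e"
  by (metis opp_in opp_opp s_opp)

lemma t_in: "e \<in> E \<Longrightarrow> t e \<in> V"
  by (metis opp_in s_in s_opp)

lemma sum_opp: "(\<Sum>e\<in>E. F (opp e)) = (\<Sum>e\<in>E. F e)"
  by (rule sum.reindex_bij_witness[where i = opp and j = opp]) (auto simp: opp_in opp_opp)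

lemma sum_fibers: "(\<Sum>v\<in>V. \<Sum>e\<in>{e\<in>E. s e = v}. F e) = (\<Sum>e\<in>E. F e)"
  using s_in by (intro sum.group finite_E finite_V) auto

lemma propagate:
  assumes "\<And>e. \<lbrakk>e \<in> E; P (s e)\<rbrakk> \<Longrightarrow> P (t e)" "P u" "u \<in> V" "v \<in> V"
  shows "P v"
proof -
  have "walk E s t \<tau> u v 0" using walks assms(3,4) .
  then show ?thesis using assms(2) by induction (use assms(1) in auto)
qed

text \<open>A discrete magnetic operator with vector potential \<open>\<alpha>\<close>. Fiber
  operators are the case of phases linear in the quasimomentum, and zero phases give the fiber at
  0.\<close>

definition magnetic :: "('v \<Rightarrow> real) \<Rightarrow> ('a \<Rightarrow> real) \<Rightarrow> ('v \<Rightarrow> complex) \<Rightarrow> 'v \<Rightarrow> complex" where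
  "magnetic q \<alpha> f v = of_real (q v) * f v - (\<Sum>e\<in>{e\<in>E. s e = v}. cis (\<alpha> e) * of_real (w e) * f (t e))"

definition antisymmetric :: "('a \<Rightarrow> real) \<Rightarrow> bool" where
  "antisymmetric \<alpha> \<longleftrightarrow> (\<forall>e\<in>E. \<alpha> (opp e) = - \<alpha> e)"

definition eigenvec :: "('v \<Rightarrow> real) \<Rightarrow> ('a \<Rightarrow> real) \<Rightarrow> real \<Rightarrow> ('v \<Rightarrow> complex) \<Rightarrow> bool" where
  "eigenvec q \<alpha> \<mu> f \<longleftrightarrow> fvec V f \<and> (\<exists>v. f v \<noteq> 0) \<and>
     (\<forall>v\<in>V. magnetic q \<alpha> f v = complex_of_real \<mu> * f v)"

definition bottom :: "('v \<Rightarrow> real) \<Rightarrow> ('a \<Rightarrow> real) \<Rightarrow> real" where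
  "bottom q \<alpha> = Min {\<mu>. \<exists>f. eigenvec q \<alpha> \<mu> f}"

definition l2 :: "('v \<Rightarrow> complex) \<Rightarrow> real" where
  "l2 f = (\<Sum>v\<in>V. (cmod (f v))\<^sup>2)"

definition qform :: "('v \<Rightarrow> real) \<Rightarrow> ('a \<Rightarrow> real) \<Rightarrow> ('v \<Rightarrow> complex) \<Rightarrow> real" where
  "qform q \<alpha> f = Re (\<Sum>v\<in>V. cnj (f v) * magnetic q \<alpha> f v)"

text \<open>The matrix of \<open>magnetic\<close>: parallel edges are added up and loops contribute
  to the diagonal.\<close>

definition kernel :: "('v \<Rightarrow> real) \<Rightarrow> ('a \<Rightarrow> real) \<Rightarrow> 'v \<Rightarrow> 'v \<Rightarrow> complex" where
  "kernel q \<alpha> v u = (if u = v then of_real (q v) else 0)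
     - (\<Sum>e\<in>{e\<in>E. s e = v \<and> t e = u}. cis (\<alpha> e) * of_real (w e))"

text \<open>Reversal by \<open>opp\<close> exchanges the edges from \<open>u\<close> to
  \<open>v\<close> with those from \<open>v\<close> to \<open>u\<close> and negates the phase, that
  is, conjugates the entry.\<close>

lemma hermitian_kernel: "antisymmetric \<alpha> \<Longrightarrow> hermitian_kernel V (kernel q \<alpha>)"
proof
  fix u v assume a: "antisymmetric \<alpha>" "u \<in> V" "v \<in> V"
  have "(\<Sum>e\<in>{e\<in>E. s e = u \<and> t e = v}. cis (\<alpha> e) * complex_of_real (w e))
      = (\<Sum>e\<in>{e\<in>E. s e = v \<and> t e = u}. cis (- \<alpha> e) * complex_of_real (w e))"
    using a(1) by (intro sum.reindex_bij_witness[where i = opp and j = opp])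
      (auto simp: opp_in opp_opp s_opp t_opp w_opp antisymmetric_def)
  then show "kernel q \<alpha> u v = cnj (kernel q \<alpha> v u)"
    by (simp add: kernel_def cis_cnj)
qed (auto simp: finite_V V_nonempty)

lemma apply_kernel_eq:
  assumes "antisymmetric \<alpha>" "v \<in> V"
  shows "hermitian_kernel.apply_kernel V (kernel q \<alpha>) f v = magnetic q \<alpha> f v"
proof -
  interpret hermitian_kernel V "kernel q \<alpha>" using hermitian_kernel assms(1) .
  have "(\<Sum>e\<in>{e\<in>E. s e = v}. cis (\<alpha> e) * of_real (w e) * f (t e))
      = (\<Sum>u\<in>V. \<Sum>e\<in>{e\<in>{e\<in>E. s e = v}. t e = u}. cis (\<alpha> e) * of_real (w e) * f (t e))"
    using t_in finite_E finite_V by (intro sum.group[symmetric]) auto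
  also have "\<dots> = (\<Sum>u\<in>V. (\<Sum>e\<in>{e\<in>E. s e = v \<and> t e = u}. cis (\<alpha> e) * of_real (w e)) * f u)"
    unfolding sum_distrib_right by (intro sum.cong refl) auto
  finally show ?thesis
    using finite_V assms(2)
    by (simp add: apply_kernel_def kernel_def magnetic_def left_diff_distrib sum_subtractf
        mult_delta_left)
qed

lemma eigen_eq: "antisymmetric \<alpha> \<Longrightarrow> hermitian_kernel.eigen V (kernel q \<alpha>) \<mu> f \<longleftrightarrow> eigenvec q \<alpha> \<mu> f"
  using apply_kernel_eq by (simp add: hermitian_kernel.eigen_def[OF hermitian_kernel] eigenvec_def)

lemma norm2_eq: "antisymmetric \<alpha> \<Longrightarrow> hermitian_kernel.norm2 V f = l2 f"
  by (simp add: hermitian_kernel.norm2_def[OF hermitian_kernel] l2_def)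

lemma rayleigh_eq: "antisymmetric \<alpha> \<Longrightarrow> hermitian_kernel.rayleigh V (kernel q \<alpha>) f = qform q \<alpha> f"
  using apply_kernel_eq by (simp add: hermitian_kernel.rayleigh_def[OF hermitian_kernel] qform_def)

lemma bottom_eigenvec: "antisymmetric \<alpha> \<Longrightarrow> \<exists>f. eigenvec q \<alpha> (bottom q \<alpha>) f \<and> l2 f = 1"
  using hermitian_kernel.Min_eigenvalue(1)[OF hermitian_kernel] hermitian_kernel.eigen_normalized[OF hermitian_kernel]
  by (simp add: bottom_def eigen_eq norm2_eq) blast

lemma bottom_le: "antisymmetric \<alpha> \<Longrightarrow> bottom q \<alpha> * l2 f \<le> qform q \<alpha> f"
  using hermitian_kernel.Min_eigenvalue(2)[OF hermitian_kernel, of \<alpha> q f]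
  by (simp add: bottom_def eigen_eq norm2_eq rayleigh_eq)

lemma qform_eigenvec: "\<lbrakk>antisymmetric \<alpha>; eigenvec q \<alpha> \<mu> f\<rbrakk> \<Longrightarrow> qform q \<alpha> f = \<mu> * l2 f"
  using hermitian_kernel.rayleigh_eigen[OF hermitian_kernel, of \<alpha> q \<mu> f]
  by (simp add: eigen_eq norm2_eq rayleigh_eq)

lemma eigenvec_of_minimizer:
  "\<lbrakk>antisymmetric \<alpha>; fvec V f; f z \<noteq> 0; qform q \<alpha> f = bottom q \<alpha> * l2 f\<rbrakk>
    \<Longrightarrow> eigenvec q \<alpha> (bottom q \<alpha>) f"
  using hermitian_kernel.eigen_of_rayleigh_minimizer[OF hermitian_kernel, of \<alpha> f z q "bottom q \<alpha>"] bottom_le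
  by (simp add: eigen_eq norm2_eq rayleigh_eq)

lemma qform_edges:
  "qform q \<alpha> f = (\<Sum>v\<in>V. q v * (cmod (f v))\<^sup>2)
     - (\<Sum>e\<in>E. w e * Re (cnj (f (s e)) * cis (\<alpha> e) * f (t e)))"
proof -
  have "(\<Sum>v\<in>V. Re (cnj (f v) * (\<Sum>e\<in>{e\<in>E. s e = v}. cis (\<alpha> e) * of_real (w e) * f (t e))))
      = (\<Sum>v\<in>V. \<Sum>e\<in>{e\<in>E. s e = v}. w e * Re (cnj (f (s e)) * cis (\<alpha> e) * f (t e)))"
    unfolding sum_distrib_left Re_sum by (intro sum.cong refl) (auto simp: algebra_simps)
  also have "\<dots> = (\<Sum>e\<in>E. w e * Re (cnj (f (s e)) * cis (\<alpha> e) * f (t e)))"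
    by (rule sum_fibers)
  finally have 1: "(\<Sum>v\<in>V. Re (cnj (f v) * (\<Sum>e\<in>{e\<in>E. s e = v}. cis (\<alpha> e) * of_real (w e) * f (t e))))
      = (\<Sum>e\<in>E. w e * Re (cnj (f (s e)) * cis (\<alpha> e) * f (t e)))" .
  have 2: "Re (cnj z * (of_real a * z - y)) = a * (cmod z)\<^sup>2 - Re (cnj z * y)" for a z y
    unfolding cmod_power2 by (simp add: power2_eq_square algebra_simps)
  show ?thesis
    unfolding qform_def magnetic_def Re_sum 2 sum_subtractf 1 ..
qed

section \<open>The ground state transform\<close>

text \<open>A positive solution \<open>\<psi>\<close> of the eigenvalue equation without magnetic phases; then \<open>\<lambda>\<close> is
  automatically the bottom of the spectrum.\<close>

definition ground :: "('v \<Rightarrow> real) \<Rightarrow> ('v \<Rightarrow> real) \<Rightarrow> real \<Rightarrow> bool" where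
  "ground q \<psi> \<mu> \<longleftrightarrow> (\<forall>v\<in>V. \<psi> v > 0) \<and>
     (\<forall>v\<in>V. q v * \<psi> v - (\<Sum>e\<in>{e\<in>E. s e = v}. w e * \<psi> (t e)) = \<mu> * \<psi> v)"

text \<open>Conductances of the edges after the substitution \<open>f = \<psi> g\<close>.\<close>

definition cond :: "('v \<Rightarrow> real) \<Rightarrow> 'a \<Rightarrow> real" where
  "cond \<psi> e = w e * \<psi> (s e) * \<psi> (t e)"

definition dirichlet :: "('v \<Rightarrow> real) \<Rightarrow> ('a \<Rightarrow> real) \<Rightarrow> ('v \<Rightarrow> complex) \<Rightarrow> real" where
  "dirichlet \<psi> \<alpha> g = (1/2) * (\<Sum>e\<in>E. cond \<psi> e * (cmod (g (s e) - cis (\<alpha> e) * g (t e)))\<^sup>2)"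

definition wl2 :: "('v \<Rightarrow> real) \<Rightarrow> ('v \<Rightarrow> complex) \<Rightarrow> real" where
  "wl2 \<psi> g = (\<Sum>v\<in>V. (\<psi> v)\<^sup>2 * (cmod (g v))\<^sup>2)"

lemma l2_times: "l2 (\<lambda>v. of_real (\<psi> v) * g v) = wl2 \<psi> g"
  by (simp add: l2_def wl2_def norm_mult power_mult_distrib)

lemma cond_opp: "e \<in> E \<Longrightarrow> cond \<psi> (opp e) = cond \<psi> e"
  by (simp add: cond_def w_opp s_opp t_opp)

lemma cond_pos: "\<lbrakk>ground q \<psi> \<mu>; e \<in> E\<rbrakk> \<Longrightarrow> cond \<psi> e > 0"
  by (simp add: cond_def ground_def w_pos s_in t_in)

lemma dirichlet_nonneg: "ground q \<psi> \<mu> \<Longrightarrow> dirichlet \<psi> \<alpha> g \<ge> 0"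
  unfolding dirichlet_def by (intro mult_nonneg_nonneg sum_nonneg) (auto dest: cond_pos)

text \<open>The equation for \<open>\<psi>\<close> eliminates the potential \<open>q\<close> in
  favour of a sum of \<open>cond\<close> over outgoing edges; the remaining terms complete the
  square on each edge.\<close>

lemma ground_state_representation:
  assumes g: "ground q \<psi> \<mu>" and \<alpha>: "antisymmetric \<alpha>"
  shows "qform q \<alpha> (\<lambda>v. of_real (\<psi> v) * g v) = \<mu> * wl2 \<psi> g + dirichlet \<psi> \<alpha> g"
proof -
  define X where "X e = Re (cnj (g (s e)) * cis (\<alpha> e) * g (t e))" for e
  have "(\<Sum>v\<in>V. q v * (cmod (of_real (\<psi> v) * g v))\<^sup>2) =
      (\<Sum>v\<in>V. (\<mu> * \<psi> v + (\<Sum>e\<in>{e\<in>E. s e = v}. w e * \<psi> (t e))) * \<psi> v * (cmod (g v))\<^sup>2)"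
  proof (rule sum.cong[OF refl])
    fix v assume "v \<in> V"
    then have "\<mu> * \<psi> v + (\<Sum>e\<in>{e\<in>E. s e = v}. w e * \<psi> (t e)) = q v * \<psi> v"
      using g by (simp add: ground_def algebra_simps)
    then show "q v * (cmod (of_real (\<psi> v) * g v))\<^sup>2 =
        (\<mu> * \<psi> v + (\<Sum>e\<in>{e\<in>E. s e = v}. w e * \<psi> (t e))) * \<psi> v * (cmod (g v))\<^sup>2"
      by (simp add: norm_mult power2_eq_square mult_ac)
  qed
  also have "\<dots> = \<mu> * wl2 \<psi> g + (\<Sum>v\<in>V. \<Sum>e\<in>{e\<in>E. s e = v}. cond \<psi> e * (cmod (g (s e)))\<^sup>2)"
    unfolding wl2_def sum_distrib_left sum.distrib[symmetric] distrib_right sum_distrib_right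
    by (intro sum.cong refl arg_cong2[where f = "(+)"]) (auto simp: cond_def power2_eq_square mult_ac)
  finally have 1: "(\<Sum>v\<in>V. q v * (cmod (of_real (\<psi> v) * g v))\<^sup>2) =
      \<mu> * wl2 \<psi> g + (\<Sum>e\<in>E. cond \<psi> e * (cmod (g (s e)))\<^sup>2)"
    by (simp only: sum_fibers)
  have 2: "(\<Sum>e\<in>E. w e * Re (cnj (of_real (\<psi> (s e)) * g (s e)) * cis (\<alpha> e) * (of_real (\<psi> (t e)) * g (t e))))
      = (\<Sum>e\<in>E. cond \<psi> e * X e)"
    by (intro sum.cong refl) (simp add: cond_def X_def algebra_simps)
  \<comment> \<open>By edge reversal both endpoints contribute equally. This accounts for the factor
    1/2 in \<open>dirichlet\<close>.\<close>
  have 3: "(\<Sum>e\<in>E. cond \<psi> e * (cmod (g (s e)))\<^sup>2) = (\<Sum>e\<in>E. cond \<psi> e * (cmod (g (t e)))\<^sup>2)"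
    using sum_opp[of "\<lambda>e. cond \<psi> e * (cmod (g (s e)))\<^sup>2"] by (simp add: cond_opp s_opp)
  have 4: "(cmod (x - cis a * y))\<^sup>2 = (cmod x)\<^sup>2 + (cmod y)\<^sup>2 - 2 * Re (cnj x * cis a * y)" for x y a
  proof -
    have "(cmod (x - cis a * y))\<^sup>2 = (cmod x)\<^sup>2 + (cmod (cis a * y))\<^sup>2 - 2 * Re (cnj x * cis a * y)"
      unfolding cmod_power2 by (simp add: power2_eq_square algebra_simps)
    then show ?thesis by (simp add: norm_mult)
  qed
  have 5: "cond \<psi> e * (cmod (g (s e) - cis (\<alpha> e) * g (t e)))\<^sup>2 =
      cond \<psi> e * (cmod (g (s e)))\<^sup>2 + cond \<psi> e * (cmod (g (t e)))\<^sup>2 - 2 * (cond \<psi> e * X e)" for e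
    unfolding 4 X_def[symmetric] by (simp add: algebra_simps)
  have "dirichlet \<psi> \<alpha> g = (\<Sum>e\<in>E. cond \<psi> e * (cmod (g (s e)))\<^sup>2) - (\<Sum>e\<in>E. cond \<psi> e * X e)"
    unfolding dirichlet_def 5 sum.distrib sum_subtractf sum_distrib_left[symmetric] 3 by simp
  then show ?thesis unfolding qform_edges 1 2 by simp
qed

lemma bottom_le_dirichlet:
  assumes "ground q \<psi> \<mu>" "antisymmetric \<alpha>"
  shows "(bottom q \<alpha> - \<mu>) * wl2 \<psi> g \<le> dirichlet \<psi> \<alpha> g"
  using bottom_le[OF assms(2), of q "\<lambda>v. of_real (\<psi> v) * g v"]
  unfolding ground_state_representation[OF assms] l2_times by (simp add: algebra_simps)

lemma dirichlet_eigenvec: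
  assumes "ground q \<psi> \<mu>" "antisymmetric \<alpha>" "eigenvec q \<alpha> \<nu> f"
  defines "g \<equiv> \<lambda>v. f v / of_real (\<psi> v)"
  shows "dirichlet \<psi> \<alpha> g = (\<nu> - \<mu>) * l2 f" "wl2 \<psi> g = l2 f"
proof -
  have f: "of_real (\<psi> v) * g v = f v" for v
  proof (cases "v \<in> V")
    case True
    then have "\<psi> v \<noteq> 0" using assms(1) by (force simp: ground_def)
    then show ?thesis by (simp add: g_def)
  next
    \<comment> \<open>The sign of \<open>\<psi>\<close> is unknown off \<open>V\<close>, but
      \<open>f\<close> vanishes there.\<close>
    case False
    then show ?thesis using assms(3) by (simp add: g_def eigenvec_def fvec_def)
  qed
  show "wl2 \<psi> g = l2 f"
    using l2_times[of \<psi> g] by (simp add: f)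
  then show "dirichlet \<psi> \<alpha> g = (\<nu> - \<mu>) * l2 f"
    using ground_state_representation[OF assms(1,2), of g] qform_eigenvec[OF assms(2,3)]
    unfolding f by (simp add: algebra_simps)
qed

lemma bottom_attained:
  assumes "ground q \<psi> \<mu>" "antisymmetric \<alpha>"
  shows "\<exists>g. wl2 \<psi> g = 1 \<and> dirichlet \<psi> \<alpha> g = bottom q \<alpha> - \<mu>"
proof -
  obtain f where f: "eigenvec q \<alpha> (bottom q \<alpha>) f" "l2 f = 1"
    using bottom_eigenvec[OF assms(2)] by blast
  from dirichlet_eigenvec[OF assms f(1)] show ?thesis unfolding f(2) by auto
qed

lemma antisymmetric_0: "antisymmetric (\<lambda>_. 0)"
  by (simp add: antisymmetric_def)

lemma bottom_ge: "\<lbrakk>ground q \<psi> \<mu>; antisymmetric \<alpha>\<rbrakk> \<Longrightarrow> \<mu> \<le> bottom q \<alpha>"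
  using bottom_attained dirichlet_nonneg by (metis diff_ge_0_iff_ge)

lemma wl2_one_pos: "ground q \<psi> \<mu> \<Longrightarrow> wl2 \<psi> (\<lambda>_. 1) > 0"
  unfolding wl2_def ground_def using V_nonempty finite_V by (intro sum_pos) auto

text \<open>Without phases the constant function has zero energy, which gives the upper bound; the
  lower bound is nonnegativity of the Dirichlet form.\<close>

lemma bottom_ground: "ground q \<psi> \<mu> \<Longrightarrow> bottom q (\<lambda>_. 0) = \<mu>"
  using bottom_le_dirichlet[of q \<psi> \<mu> "\<lambda>_. 0" "\<lambda>_. 1"] bottom_ge[of q \<psi> \<mu> "\<lambda>_. 0"] wl2_one_pos[of q \<psi> \<mu>]
  by (auto simp: dirichlet_def antisymmetric_0 mult_le_0_iff)

lemma dirichlet_0D: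
  assumes "ground q \<psi> \<mu>" "dirichlet \<psi> \<alpha> g = 0" "e \<in> E"
  shows "g (s e) = cis (\<alpha> e) * g (t e)"
proof -
  have "cond \<psi> e * (cmod (g (s e) - cis (\<alpha> e) * g (t e)))\<^sup>2 = 0"
    using assms(2,3) cond_pos[OF assms(1)] finite_E unfolding dirichlet_def
    by (subst (asm) mult_eq_0_iff, subst (asm) sum_nonneg_eq_0_iff) (auto intro!: mult_nonneg_nonneg intro: less_imp_le)
  then show ?thesis using cond_pos[OF assms(1,3)] by simp
qed

lemma ground_eigenvec:
  assumes "ground q \<psi> \<mu>" "fvec V (\<lambda>v. complex_of_real (\<psi> v))"
  shows "eigenvec q (\<lambda>_. 0) \<mu> (\<lambda>v. complex_of_real (\<psi> v))"
proof -
  have "magnetic q (\<lambda>_. 0) (\<lambda>v. complex_of_real (\<psi> v)) v = of_real \<mu> * of_real (\<psi> v)" if "v \<in> V" for v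
  proof -
    have "q v * \<psi> v - (\<Sum>e\<in>{e\<in>E. s e = v}. w e * \<psi> (t e)) = \<mu> * \<psi> v"
      using assms(1) that by (simp add: ground_def)
    from arg_cong[OF this, of complex_of_real] show ?thesis
      by (simp add: magnetic_def)
  qed
  moreover obtain z where "z \<in> V" using V_nonempty by blast
  then have "\<psi> z \<noteq> 0" using assms(1) by (force simp: ground_def)
  ultimately show ?thesis using assms(2) by (auto simp: eigenvec_def)
qed

text \<open>The quotient of \<open>f\<close> by \<open>\<psi>\<close> has zero energy, so it agrees
  at the ends of every edge, and connectedness makes it constant.\<close>

lemma ground_simple:
  assumes g: "ground q \<psi> \<mu>" and f: "eigenvec q (\<lambda>_. 0) \<mu> f"
  shows "\<exists>c. \<forall>v\<in>V. f v = c * of_real (\<psi> v)"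
proof -
  define g where "g v = f v / of_real (\<psi> v)" for v
  have "dirichlet \<psi> (\<lambda>_. 0) g = 0"
    using dirichlet_eigenvec(1)[OF assms(1) antisymmetric_0 f] unfolding g_def by simp
  from dirichlet_0D[OF assms(1) this] have e: "g (s e) = g (t e)" if "e \<in> E" for e
    using that by simp
  obtain z where z: "z \<in> V" using V_nonempty by blast
  have "g v = g z" if "v \<in> V" for v
    by (rule propagate[where P = "\<lambda>v. g v = g z" and u = z]) (use e z that in auto)
  moreover have "\<psi> v \<noteq> 0" if "v \<in> V" for v using that assms(1) by (force simp: ground_def)
  ultimately have "\<forall>v\<in>V. f v = g z * of_real (\<psi> v)"
    unfolding g_def by (metis nonzero_eq_divide_eq of_real_eq_0_iff)
  then show ?thesis by blast
qed

text \<open>Replacing the lowest eigenvector by its modulus does not increase the form.\<close>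

lemma ex_ground: "\<exists>\<psi>. ground q \<psi> (bottom q (\<lambda>_. 0)) \<and> (\<forall>v. v \<notin> V \<longrightarrow> \<psi> v = 0)"
proof -
  let ?\<mu> = "bottom q (\<lambda>_. 0)"
  obtain f where f: "eigenvec q (\<lambda>_. 0) ?\<mu> f"
    using bottom_eigenvec[OF antisymmetric_0] by blast
  define p where "p v = cmod (f v)" for v
  obtain z where z: "f z \<noteq> 0" "z \<in> V" using f by (auto simp: eigenvec_def fvec_def)
  have out: "p v = 0" if "v \<notin> V" for v using f that by (simp add: p_def eigenvec_def fvec_def)
  have l: "l2 (\<lambda>v. of_real (p v)) = l2 f" by (simp add: l2_def p_def)
  have "qform q (\<lambda>_. 0) (\<lambda>v. of_real (p v)) \<le> qform q (\<lambda>_. 0) f"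
  proof -
    have "Re (cnj x * y) \<le> cmod x * cmod y" for x y
      by (metis complex_Re_le_cmod norm_mult complex_mod_cnj)
    then show ?thesis
      unfolding qform_edges
      by (intro diff_mono sum_mono) (auto simp: p_def intro!: mult_left_mono less_imp_le[OF w_pos])
  qed
  then have "qform q (\<lambda>_. 0) (\<lambda>v. of_real (p v)) = ?\<mu> * l2 (\<lambda>v. of_real (p v))"
    using bottom_le[OF antisymmetric_0, of q "\<lambda>v. of_real (p v)"] qform_eigenvec[OF antisymmetric_0 f]
    by (simp add: l)
  then have "eigenvec q (\<lambda>_. 0) ?\<mu> (\<lambda>v. of_real (p v))"
    using z(1) out by (intro eigenvec_of_minimizer[OF antisymmetric_0, where z = z])
      (simp_all add: fvec_def, simp add: p_def)
  then have eq': "magnetic q (\<lambda>_. 0) (\<lambda>v. of_real (p v)) v = of_real ?\<mu> * of_real (p v)" if "v \<in> V" for v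
    using that by (simp add: eigenvec_def)
  have eq: "q v * p v - (\<Sum>e\<in>{e\<in>E. s e = v}. w e * p (t e)) = ?\<mu> * p v" if "v \<in> V" for v
  proof -
    have "complex_of_real (q v * p v - (\<Sum>e\<in>{e\<in>E. s e = v}. w e * p (t e))) = of_real (?\<mu> * p v)"
      using eq'[OF that] by (simp add: magnetic_def)
    then show ?thesis by (simp only: of_real_eq_iff)
  qed
  \<comment> \<open>A discrete strong maximum principle: at a zero of \<open>p\<close> the
    eigenvalue equation makes a sum of nonnegative neighbour terms vanish, so zeros spread along
    edges.\<close>
  have zero: "p (t e) = 0" if "e \<in> E" "p (s e) = 0" for e
  proof -
    have "(\<Sum>e'\<in>{e'\<in>E. s e' = s e}. w e' * p (t e')) = 0"
      using eq[OF s_in[OF that(1)]] that(2) by simp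
    then have "w e * p (t e) = 0"
      using that(1) finite_E by (subst (asm) sum_nonneg_eq_0_iff) (auto simp: p_def w_pos less_imp_le)
    then show ?thesis using w_pos[OF that(1)] by simp
  qed
  have "p v > 0" if "v \<in> V" for v
  proof (rule ccontr)
    assume "\<not> p v > 0"
    then have "p v = 0" by (simp add: p_def)
    then have "p z = 0"
      using propagate[where P = "\<lambda>v. p v = 0", OF zero _ that z(2)] by blast
    then show False using z by (simp add: p_def)
  qed
  then show ?thesis using eq out unfolding ground_def by blast
qed

end

section \<open>Phases and comparison of two potentials\<close>

lemma iprod_inner: "iprod m \<theta> = (\<chi> i. real_of_int (m $ i)) \<bullet> \<theta>"
  by (simp add: iprod_def inner_vec_def)

lemma iprod_simps:
  "iprod (m + n) \<theta> = iprod m \<theta> + iprod n \<theta>" "iprod (- m) \<theta> = - iprod m \<theta>" "iprod m 0 = 0"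
  "iprod 0 \<theta> = 0" "iprod m (c *\<^sub>R \<theta>) = c * iprod m \<theta>"
  by (simp_all add: iprod_def algebra_simps sum.distrib sum_negf sum_distrib_left)

lemma iprod_axis: "iprod (axis i 1) \<theta> = \<theta> $ i"
  by (simp add: iprod_def axis_def if_distrib if_distribR sum.delta cong: if_cong)

lemma cmod_cis_minus_one: "cmod (1 - cis x) \<le> \<bar>x\<bar>"
proof -
  have "(cmod (1 - cis x))\<^sup>2 = 2 - 2 * cos x"
    unfolding cmod_power2 using sin_cos_squared_add[of x] by (simp add: power2_eq_square algebra_simps)
  also have "\<dots> = (2 * sin (x / 2))\<^sup>2"
    using cos_double_sin[of "x / 2"] by (simp add: power2_eq_square)
  also have "\<dots> \<le> x\<^sup>2"
    using abs_sin_x_le_abs_x[of "x / 2"] unfolding abs_le_square_iff[symmetric] by simp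
  finally show ?thesis by (simp add: abs_le_square_iff[symmetric])
qed

context quotient_graph
begin

definition phase :: "real^'d \<Rightarrow> 'a \<Rightarrow> real" where
  "phase \<theta> e = iprod (\<tau> e) \<theta>"

lemma antisymmetric_phase: "antisymmetric (phase \<theta>)"
  by (simp add: antisymmetric_def phase_def \<tau>_opp iprod_simps)

lemma phase_0: "phase 0 = (\<lambda>_. 0)"
  by (simp add: phase_def fun_eq_iff iprod_simps)

lemma phase_bound: "\<exists>T\<ge>0. \<forall>e\<in>E. \<forall>\<theta>. \<bar>phase \<theta> e\<bar> \<le> T * norm \<theta>"
proof -
  define T where "T = (\<Sum>e\<in>E. norm (\<chi> i. real_of_int (\<tau> e $ i)))"
  have "\<bar>phase \<theta> e\<bar> \<le> T * norm \<theta>" if "e \<in> E" for e \<theta>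
  proof -
    have "\<bar>phase \<theta> e\<bar> \<le> norm (\<chi> i. real_of_int (\<tau> e $ i)) * norm \<theta>"
      unfolding phase_def iprod_inner by (rule Cauchy_Schwarz_ineq2)
    also have "\<dots> \<le> T * norm \<theta>"
      unfolding T_def using finite_E that by (intro mult_right_mono member_le_sum) auto
    finally show ?thesis .
  qed
  moreover have "T \<ge> 0" by (simp add: T_def sum_nonneg)
  ultimately show ?thesis by blast
qed

text \<open>Edge phases multiply along a walk. For a closed walk this is the holonomy, which a
  nonzero solution forces to be trivial.\<close>

lemma walk_phase_cocycle:
  assumes "walk E s t \<tau> u v m" "\<And>e. e \<in> E \<Longrightarrow> g (s e) = cis (phase \<theta> e) * g (t e)"
  shows "g u = cis (iprod m \<theta>) * g v"
  using assms(1)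
proof induction
  case (walk_step u v m e)
  have "g u = cis (iprod m \<theta>) * (cis (phase \<theta> e) * g (t e))"
    using walk_step assms(2)[of e] by simp
  then show ?case by (simp add: iprod_simps phase_def cis_mult[symmetric] mult.assoc)
qed (simp add: iprod_simps)

text \<open>The additive counterpart: the differences of \<open>h\<close> telescope along the
  walk.\<close>

lemma walk_potential:
  fixes h :: "'v \<Rightarrow> real"
  assumes "walk E s t \<tau> u v m" "\<And>e. e \<in> E \<Longrightarrow> phase \<theta> e + h (t e) - h (s e) = 0"
  shows "h u - h v = iprod m \<theta>"
  using assms(1)
proof induction
  case (walk_step u v m e)
  then show ?case using assms(2)[of e] by (simp add: iprod_simps phase_def)
qed (simp add: iprod_simps)

lemma cos_one_less_one: "cos (1::real) < 1"
  using cos_monotone_0_pi[of 0 1] pi_gt3 by simp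

text \<open>Equality would give a minimizer \<open>k\<close> of zero energy. A closed walk of index
  \<open>axis i 1\<close> multiplies it by \<open>cis 1\<close>, which is not 1, so \<open>k\<close>
  would vanish on \<open>V\<close>.\<close>

lemma bottom_nonconstant:
  assumes g: "ground q \<psi> \<mu>" and i: "\<theta> $ i = 1"
  shows "\<mu> < bottom q (phase \<theta>)"
proof (rule ccontr)
  assume "\<not> \<mu> < bottom q (phase \<theta>)"
  with bottom_ge[OF g antisymmetric_phase, of \<theta>] have eq: "bottom q (phase \<theta>) - \<mu> = 0"
    by simp
  obtain k where k: "wl2 \<psi> k = 1" "dirichlet \<psi> (phase \<theta>) k = 0"
    using bottom_attained[OF g antisymmetric_phase] unfolding eq[symmetric] by metis
  have "k u = 0" if "u \<in> V" for u
  proof -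
    have "k u = cis (iprod (axis i 1) \<theta>) * k u"
      using walk_phase_cocycle[OF walks[OF that that] dirichlet_0D[OF g k(2)]] by blast
    then have "k u = cis 1 * k u" by (simp add: iprod_axis i)
    moreover have "cis 1 \<noteq> 1" using cos_one_less_one by (metis cis.simps(1) less_irrefl one_complex.simps(1))
    ultimately show ?thesis by (metis mult_cancel_right1)
  qed
  then show False using k(1) by (simp add: wl2_def)
qed

text \<open>The constant function is the trial function; its edge differences have modulus at most 2
  whatever \<open>\<alpha>\<close> is. The bound makes the supremum of a band meaningful.\<close>

lemma bottom_bounded:
  assumes "ground q \<psi> \<mu>"
  shows "\<exists>C. \<forall>\<alpha>. antisymmetric \<alpha> \<longrightarrow> bottom q \<alpha> \<le> C"
proof -
  have N: "wl2 \<psi> (\<lambda>_. 1) > 0" using assms by (rule wl2_one_pos)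
  have "bottom q \<alpha> \<le> \<mu> + ((1/2) * (\<Sum>e\<in>E. cond \<psi> e * 2\<^sup>2)) / wl2 \<psi> (\<lambda>_. 1)" if "antisymmetric \<alpha>" for \<alpha>
  proof -
    have "cmod (1 - cis (\<alpha> e)) \<le> 2" for e
      using norm_triangle_ineq4[of 1 "cis (\<alpha> e)"] by simp
    then have "dirichlet \<psi> \<alpha> (\<lambda>_. 1) \<le> (1/2) * (\<Sum>e\<in>E. cond \<psi> e * 2\<^sup>2)"
      unfolding dirichlet_def
      by (intro mult_left_mono sum_mono power_mono) (auto intro: less_imp_le[OF cond_pos[OF assms]])
    with bottom_le_dirichlet[OF assms that, of "\<lambda>_. 1"]
    have "(bottom q \<alpha> - \<mu>) * wl2 \<psi> (\<lambda>_. 1) \<le> (1/2) * (\<Sum>e\<in>E. cond \<psi> e * 2\<^sup>2)" by linarith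
    then have "bottom q \<alpha> - \<mu> \<le> ((1/2) * (\<Sum>e\<in>E. cond \<psi> e * 2\<^sup>2)) / wl2 \<psi> (\<lambda>_. 1)"
      using N by (simp only: pos_le_divide_eq)
    then show ?thesis by linarith
  qed
  then show ?thesis by blast
qed

section \<open>Two ground states with bounded ratio\<close>

context
  fixes \<psi> \<psi>' :: "'v \<Rightarrow> real" and q q' :: "'v \<Rightarrow> real" and \<mu> \<mu>' a b :: real
  assumes gr: "ground q \<psi> \<mu>" "ground q' \<psi>' \<mu>'" and a_pos: "a > 0"
    and between: "\<And>v. v \<in> V \<Longrightarrow> a * \<psi>' v \<le> \<psi> v" "\<And>v. v \<in> V \<Longrightarrow> \<psi> v \<le> b * \<psi>' v"
begin

lemma cond_compare: "e \<in> E \<Longrightarrow> cond \<psi> e \<le> b\<^sup>2 * cond \<psi>' e"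
proof -
  assume e: "e \<in> E"
  have p: "\<psi> v > 0" "\<psi>' v > 0" if "v \<in> V" for v using that gr by (auto simp: ground_def)
  have "\<psi> (s e) * \<psi> (t e) \<le> (b * \<psi>' (s e)) * (b * \<psi>' (t e))"
    using e p[of "s e"] p[of "t e"] between(2)[of "s e"] between(2)[of "t e"] s_in t_in
    by (intro mult_mono) (auto intro: less_imp_le order_trans)
  from mult_left_mono[OF this less_imp_le[OF w_pos[OF e]]]
  show ?thesis by (simp add: cond_def power2_eq_square mult_ac)
qed

lemma wl2_compare: "a\<^sup>2 * wl2 \<psi>' g \<le> wl2 \<psi> g"
proof -
  have "a\<^sup>2 * ((\<psi>' v)\<^sup>2 * (cmod (g v))\<^sup>2) \<le> (\<psi> v)\<^sup>2 * (cmod (g v))\<^sup>2" if "v \<in> V" for v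
  proof -
    have "0 \<le> a * \<psi>' v" using that gr a_pos by (simp add: ground_def less_imp_le)
    from power_mono[OF between(1)[OF that] this, of 2]
    show ?thesis by (simp add: power_mult_distrib mult.assoc[symmetric] mult_right_mono)
  qed
  then show ?thesis unfolding wl2_def sum_distrib_left by (rule sum_mono)
qed

text \<open>The optimal \<open>g\<close> for \<open>\<psi>'\<close> serves as trial function for
  \<open>\<psi>\<close>. Its energy grows at most by the factor \<open>b\<^sup>2\<close> and its
  squared norm keeps at least the factor \<open>a\<^sup>2\<close>; \<open>bottom_ge\<close> supplies
  the sign needed to use the latter.\<close>

lemma bottom_compare:
  assumes "antisymmetric \<alpha>"
  shows "a\<^sup>2 * (bottom q \<alpha> - \<mu>) \<le> b\<^sup>2 * (bottom q' \<alpha> - \<mu>')"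
proof -
  obtain g where g: "wl2 \<psi>' g = 1" "dirichlet \<psi>' \<alpha> g = bottom q' \<alpha> - \<mu>'"
    using bottom_attained[OF gr(2) assms] by blast
  have "a\<^sup>2 * (bottom q \<alpha> - \<mu>) \<le> (bottom q \<alpha> - \<mu>) * wl2 \<psi> g"
    using wl2_compare[of g] g(1) bottom_ge[OF gr(1) assms]
    by (simp add: mult.commute[of _ "bottom q \<alpha> - \<mu>"] mult_left_mono)
  also have "\<dots> \<le> dirichlet \<psi> \<alpha> g" by (rule bottom_le_dirichlet[OF gr(1) assms])
  also have "\<dots> \<le> b\<^sup>2 * dirichlet \<psi>' \<alpha> g"
  proof -
    have "(\<Sum>e\<in>E. cond \<psi> e * (cmod (g (s e) - cis (\<alpha> e) * g (t e)))\<^sup>2)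
        \<le> (\<Sum>e\<in>E. (b\<^sup>2 * cond \<psi>' e) * (cmod (g (s e) - cis (\<alpha> e) * g (t e)))\<^sup>2)"
      by (intro sum_mono mult_right_mono cond_compare) auto
    also have "\<dots> = b\<^sup>2 * (\<Sum>e\<in>E. cond \<psi>' e * (cmod (g (s e) - cis (\<alpha> e) * g (t e)))\<^sup>2)"
      by (simp add: sum_distrib_left mult.assoc)
    finally show ?thesis by (simp add: dirichlet_def)
  qed
  finally show ?thesis by (simp add: g(2))
qed

end

section \<open>Correctors\<close>

text \<open>Along a walk of \<open>n\<close> edges a function changes by at most
  \<open>n * \<delta>\<close>. One walk is fixed for each pair of vertices and \<open>K\<close> is
  the sum of the lengths. The codomain is general because both real correctors and complex
  minimizers are treated.\<close>

lemma oscillation: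
  "\<exists>K\<ge>0. \<forall>(g :: 'v \<Rightarrow> 'b::real_normed_vector) \<delta>. \<delta> \<ge> 0 \<longrightarrow> (\<forall>e\<in>E. norm (g (t e) - g (s e)) \<le> \<delta>) \<longrightarrow>
     (\<forall>u\<in>V. \<forall>v\<in>V. norm (g v - g u) \<le> K * \<delta>)"
proof -
  let ?P = "\<lambda>p n. \<forall>(g :: 'v \<Rightarrow> 'b) \<delta>. \<delta> \<ge> 0 \<longrightarrow> (\<forall>e\<in>E. norm (g (t e) - g (s e)) \<le> \<delta>) \<longrightarrow>
     norm (g (snd p) - g (fst p)) \<le> n * \<delta>"
  have step: "\<exists>n\<ge>0. ?P (u, v) n" if "walk E s t \<tau> u v m" for u v m
    using that
  proof induction
    case walk_refl
    show ?case by (rule exI[of _ 0]) auto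
  next
    case (walk_step u v m e)
    then obtain n where n: "n \<ge> 0" "?P (u, v) n" by blast
    have "norm (g (t e) - g u) \<le> (n + 1) * \<delta>"
      if "\<delta> \<ge> 0" "\<forall>e\<in>E. norm (g (t e) - g (s e)) \<le> \<delta>" for g :: "'v \<Rightarrow> 'b" and \<delta>
    proof -
      have "norm (g v - g u) \<le> n * \<delta>" using n(2) that by auto
      moreover have "norm (g (t e) - g v) \<le> \<delta>" using walk_step that by auto
      ultimately show ?thesis
        using norm_triangle_ineq[of "g (t e) - g v" "g v - g u"] by (simp add: algebra_simps)
    qed
    then show ?case using n(1) by (intro exI[of _ "n + 1"]) auto
  qed
  have "\<forall>p\<in>V \<times> V. \<exists>n\<ge>0. ?P p n"
  proof
    fix p assume "p \<in> V \<times> V"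
    then have "walk E s t \<tau> (fst p) (snd p) 0" by (intro walks) auto
    from step[OF this] show "\<exists>n\<ge>0. ?P p n" by simp
  qed
  then obtain n where n: "\<And>p. p \<in> V \<times> V \<Longrightarrow> n p \<ge> 0 \<and> ?P p (n p)"
    by metis
  define K where "K = sum n (V \<times> V)"
  have "norm (g v - g u) \<le> K * \<delta>"
    if "\<delta> \<ge> 0" "\<forall>e\<in>E. norm (g (t e) - g (s e)) \<le> \<delta>" "u \<in> V" "v \<in> V" for g :: "'v \<Rightarrow> 'b" and \<delta> u v
  proof -
    have "norm (g v - g u) \<le> n (u, v) * \<delta>" using n[of "(u, v)"] that by auto
    also have "\<dots> \<le> K * \<delta>"
      unfolding K_def using that n finite_V by (intro mult_right_mono member_le_sum) auto
    finally show ?thesis .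
  qed
  moreover have "K \<ge> 0" unfolding K_def using n by (intro sum_nonneg) auto
  ultimately show ?thesis by blast
qed

text \<open>The energy of the one-form \<open>\<beta>\<close> plus the discrete gradient of
  \<open>h\<close>. Minimizing over \<open>h\<close> selects the representative of least energy in
  the cohomology class of \<open>\<beta>\<close>. There is no factor 1/2, in contrast to
  \<open>dirichlet\<close>.\<close>

definition twist :: "('v \<Rightarrow> real) \<Rightarrow> ('a \<Rightarrow> real) \<Rightarrow> ('v \<Rightarrow> real) \<Rightarrow> real" where
  "twist \<psi> \<beta> h = (\<Sum>e\<in>E. cond \<psi> e * (\<beta> e + h (t e) - h (s e))\<^sup>2)"

lemma twist_nonneg: "ground q \<psi> \<mu> \<Longrightarrow> twist \<psi> \<beta> h \<ge> 0"
  unfolding twist_def by (intro sum_nonneg mult_nonneg_nonneg) (auto dest: cond_pos)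

text \<open>Only differences of \<open>h\<close> matter, so \<open>h\<close> may vanish at
  \<open>z\<close>. A competitor no worse than 0 then has bounded differences along edges, hence
  lies in a compact box by \<open>oscillation\<close>, and the minimum over this box is
  global.\<close>

lemma twist_attains_min:
  assumes "ground q \<psi> \<mu>"
  shows "\<exists>h. \<forall>k. twist \<psi> \<beta> h \<le> twist \<psi> \<beta> k"
proof -
  obtain z where z: "z \<in> V" using V_nonempty by blast
  obtain K :: real where K: "K \<ge> 0"
    "\<And>(g :: 'v \<Rightarrow> real) \<delta> u v. \<lbrakk>\<delta> \<ge> 0; \<forall>e\<in>E. norm (g (t e) - g (s e)) \<le> \<delta>; u \<in> V; v \<in> V\<rbrakk> \<Longrightarrow> norm (g v - g u) \<le> K * \<delta>"
    using oscillation by metis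
  let ?F = "twist \<psi> \<beta>"
  \<comment> \<open>Each summand bounds the difference along one edge for a competitor no worse than
    0; the sum serves as a common bound.\<close>
  define D where "D = (\<Sum>e\<in>E. \<bar>\<beta> e\<bar> + sqrt (?F (\<lambda>_. 0) / cond \<psi> e))"
  have F0: "?F (\<lambda>_. 0) \<ge> 0" using twist_nonneg[OF assms] .
  have Dterm: "0 \<le> \<bar>\<beta> e\<bar> + sqrt (?F (\<lambda>_. 0) / cond \<psi> e)" if "e \<in> E" for e
    using F0 cond_pos[OF assms that] by simp
  then have D: "D \<ge> 0" unfolding D_def by (intro sum_nonneg) auto
  define B where "B v = (if v \<in> V then {- (K * D)..K * D} else {0})" for v
  let ?S = "{h. \<forall>v. h v \<in> B v}"
  have "compact ?S" by (rule compact_function_box) (simp add: B_def)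
  moreover have S0: "(\<lambda>_. 0) \<in> ?S" using K D by (simp add: B_def)
  moreover have "continuous_on ?S ?F"
    unfolding twist_def
    by (intro continuous_intros continuous_on_subset[OF continuous_on_product_coordinates]) auto
  ultimately obtain h where h: "h \<in> ?S" "\<And>k. k \<in> ?S \<Longrightarrow> ?F h \<le> ?F k"
    using continuous_attains_inf[of ?S ?F] by (metis (no_types, lifting) empty_iff)
  have "?F h \<le> ?F k" for k
  proof (cases "?F k \<le> ?F (\<lambda>_. 0)")
    case False
    then show ?thesis using h(2)[OF S0] by linarith
  next
    case True
    have "norm (k (t e) - k (s e)) \<le> D" if e: "e \<in> E" for e
    proof -
      have c: "cond \<psi> e > 0" using cond_pos[OF assms e] .
      have "cond \<psi> e * (\<beta> e + k (t e) - k (s e))\<^sup>2 \<le> ?F k"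
        unfolding twist_def using e finite_E
        by (intro member_le_sum) (auto intro!: mult_nonneg_nonneg less_imp_le[OF cond_pos[OF assms]])
      then have "(\<beta> e + k (t e) - k (s e))\<^sup>2 \<le> ?F (\<lambda>_. 0) / cond \<psi> e"
        using c True by (simp add: field_simps)
      then have "\<bar>\<beta> e + k (t e) - k (s e)\<bar> \<le> sqrt (?F (\<lambda>_. 0) / cond \<psi> e)"
        by (simp add: real_le_rsqrt)
      then have "norm (k (t e) - k (s e)) \<le> \<bar>\<beta> e\<bar> + sqrt (?F (\<lambda>_. 0) / cond \<psi> e)"
        by (simp add: abs_if split: if_splits)
      also have "\<dots> \<le> D"
        unfolding D_def using e finite_E Dterm by (intro member_le_sum) auto
      finally show ?thesis .
    qed
    with K(2)[of D k z] D z have osc: "\<bar>k v - k z\<bar> \<le> K * D" if "v \<in> V" for v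
      using that by simp
    \<comment> \<open>Shifting by a constant and cutting off outside \<open>V\<close> leave the
      energy unchanged and bring \<open>k\<close> into the box.\<close>
    define k' where "k' v = (if v \<in> V then k v - k z else 0)" for v
    have "?F k' = ?F k"
      unfolding twist_def by (intro sum.cong refl) (simp add: k'_def s_in t_in add_diff_eq)
    moreover have "k' v \<in> B v" for v
      using osc[of v] by (auto simp: k'_def B_def abs_le_iff)
    then have "k' \<in> ?S" by blast
    ultimately show ?thesis using h(2)[of k'] by simp
  qed
  then show ?thesis by blast
qed

lemma twist_add:
  "twist \<psi> \<beta> (\<lambda>v. h v + r * k v) = twist \<psi> \<beta> h
     + 2 * r * (\<Sum>e\<in>E. cond \<psi> e * (\<beta> e + h (t e) - h (s e)) * (k (t e) - k (s e)))
     + r\<^sup>2 * twist \<psi> (\<lambda>_. 0) k"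
  unfolding twist_def sum_distrib_left sum.distrib[symmetric]
  by (intro sum.cong refl) (simp add: power2_eq_square algebra_simps)

text \<open>The Euler-Lagrange equation of the minimization. It is linear in \<open>\<beta>\<close>
  and \<open>h\<close> jointly, so correctors can be superposed.\<close>

lemma ex_corrector:
  assumes "ground q \<psi> \<mu>"
  shows "\<exists>h. \<forall>k. (\<Sum>e\<in>E. cond \<psi> e * (\<beta> e + h (t e) - h (s e)) * (k (t e) - k (s e))) = 0"
proof -
  obtain h where h: "\<And>k. twist \<psi> \<beta> h \<le> twist \<psi> \<beta> k"
    using twist_attains_min[OF assms] by blast
  have "(\<Sum>e\<in>E. cond \<psi> e * (\<beta> e + h (t e) - h (s e)) * (k (t e) - k (s e))) = 0" for k
  proof (rule linear_term_zero_of_nonneg)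
    fix r
    show "0 \<le> 2 * r * (\<Sum>e\<in>E. cond \<psi> e * (\<beta> e + h (t e) - h (s e)) * (k (t e) - k (s e)))
        + r\<^sup>2 * twist \<psi> (\<lambda>_. 0) k"
      using h[of "\<lambda>v. h v + r * k v"] unfolding twist_add by linarith
  qed
  then show ?thesis by blast
qed

end

section \<open>Second order expansion of the lowest band function\<close>

definition quad :: "real^'d^'d \<Rightarrow> real^'d \<Rightarrow> real" where
  "quad M \<theta> = (\<Sum>i\<in>UNIV. \<Sum>j\<in>UNIV. M $ i $ j * \<theta> $ i * \<theta> $ j)"

lemma quad_inner: "quad M \<theta> = \<theta> \<bullet> (M *v \<theta>)"
  by (simp add: quad_def inner_vec_def matrix_vector_mult_def sum_distrib_left mult_ac)

lemma quad_scale: "quad M (c *\<^sub>R \<theta>) = c\<^sup>2 * quad M \<theta>"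
  by (simp add: quad_inner matrix_vector_mult_scaleR power2_eq_square)

lemma abs_sin_minus_self: "\<bar>sin x - x\<bar> \<le> x\<^sup>2" for x :: real
proof -
  have "(\<Sum>m<2. sin_coeff m * x ^ m) = x" by (simp add: numeral_2_eq_2 sin_coeff_def)
  with Maclaurin_sin_bound[of x 2] have "\<bar>sin x - x\<bar> \<le> inverse 2 * x\<^sup>2" by simp
  also have "\<dots> \<le> x\<^sup>2" by simp
  finally show ?thesis .
qed

context quotient_graph
begin

text \<open>The quadratic form of \<open>M\<close> is the minimal twist energy: this characterises the Hessian of
  the lowest band function.\<close>

definition homogenized :: "('v \<Rightarrow> real) \<Rightarrow> real^'d^'d \<Rightarrow> bool" where
  "homogenized \<psi> M \<longleftrightarrow> transpose M = M \<and>
     (\<forall>\<theta> h. quad M \<theta> * wl2 \<psi> (\<lambda>_. 1) \<le> twist \<psi> (phase \<theta>) h) \<and>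
     (\<forall>\<theta>. \<exists>h. quad M \<theta> * wl2 \<psi> (\<lambda>_. 1) = twist \<psi> (phase \<theta>) h)"

text \<open>Take a corrector \<open>H j\<close> for each coordinate of \<open>\<tau>\<close>. By
  linearity \<open>h \<theta>\<close> is a corrector for \<open>phase \<theta>\<close>, so the
  minimal energy is a quadratic form in \<open>\<theta>\<close>.\<close>

lemma ex_homogenized:
  assumes g: "ground q \<psi> \<mu>"
  shows "\<exists>M. homogenized \<psi> M"
proof -
  have "\<forall>j. \<exists>h. \<forall>k. (\<Sum>e\<in>E. cond \<psi> e * (real_of_int (\<tau> e $ j) + h (t e) - h (s e)) * (k (t e) - k (s e))) = 0"
    by (intro allI ex_corrector[OF g])
  from choice[OF this] obtain H where H: "\<And>j k. (\<Sum>e\<in>E. cond \<psi> e * (real_of_int (\<tau> e $ j) + H j (t e) - H j (s e)) * (k (t e) - k (s e))) = 0"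
    by blast
  define X where "X j e = real_of_int (\<tau> e $ j) + H j (t e) - H j (s e)" for j e
  define N where "N = wl2 \<psi> (\<lambda>_. 1)"
  have N: "N > 0" unfolding N_def using g by (rule wl2_one_pos)
  \<comment> \<open>The Gram matrix of the corrected coordinate forms for the inner product weighted
    by \<open>cond\<close>, normalized by the squared norm of \<open>\<psi>\<close>.\<close>
  define M :: "real^'d^'d" where "M = (\<chi> i j. (\<Sum>e\<in>E. cond \<psi> e * X i e * X j e) / N)"
  define h where "h \<theta> v = (\<Sum>j\<in>UNIV. \<theta> $ j * H j v)" for \<theta> :: "real^'d" and v
  have X: "phase \<theta> e + h \<theta> (t e) - h \<theta> (s e) = (\<Sum>j\<in>UNIV. \<theta> $ j * X j e)" for \<theta> e
    by (simp add: phase_def iprod_def h_def X_def algebra_simps sum.distrib sum_subtractf)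
  have quadM: "quad M \<theta> * N = twist \<psi> (phase \<theta>) (h \<theta>)" for \<theta>
  proof -
    have "M $ i $ j * \<theta> $ i * \<theta> $ j * N = (\<Sum>e\<in>E. cond \<psi> e * X i e * X j e) * \<theta> $ i * \<theta> $ j" for i j
      using N by (simp add: M_def)
    then have "quad M \<theta> * N = (\<Sum>i\<in>UNIV. \<Sum>j\<in>UNIV. \<Sum>e\<in>E. cond \<psi> e * X i e * X j e * \<theta> $ i * \<theta> $ j)"
      unfolding quad_def sum_distrib_right by simp
    also have "\<dots> = (\<Sum>i\<in>UNIV. \<Sum>e\<in>E. \<Sum>j\<in>UNIV. cond \<psi> e * X i e * X j e * \<theta> $ i * \<theta> $ j)"
      by (intro sum.cong refl sum.swap)
    also have "\<dots> = (\<Sum>e\<in>E. \<Sum>i\<in>UNIV. \<Sum>j\<in>UNIV. cond \<psi> e * X i e * X j e * \<theta> $ i * \<theta> $ j)"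
      by (rule sum.swap)
    also have "\<dots> = (\<Sum>e\<in>E. cond \<psi> e * (\<Sum>j\<in>UNIV. \<theta> $ j * X j e)\<^sup>2)"
      unfolding power2_eq_square sum_product
      by (simp add: sum_distrib_left mult_ac)
    finally show ?thesis by (simp add: twist_def X)
  qed
  have ortho: "(\<Sum>e\<in>E. cond \<psi> e * (phase \<theta> e + h \<theta> (t e) - h \<theta> (s e)) * (k (t e) - k (s e))) = 0" for \<theta> k
  proof -
    have "(\<Sum>e\<in>E. cond \<psi> e * (phase \<theta> e + h \<theta> (t e) - h \<theta> (s e)) * (k (t e) - k (s e)))
        = (\<Sum>e\<in>E. \<Sum>j\<in>UNIV. \<theta> $ j * (cond \<psi> e * X j e * (k (t e) - k (s e))))"
      unfolding X sum_distrib_left sum_distrib_right by (intro sum.cong refl) (simp add: mult_ac)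
    also have "\<dots> = (\<Sum>j\<in>UNIV. \<theta> $ j * (\<Sum>e\<in>E. cond \<psi> e * X j e * (k (t e) - k (s e))))"
      unfolding sum_distrib_left by (rule sum.swap)
    also have "\<dots> = 0" by (simp add: X_def H)
    finally show ?thesis .
  qed
  \<comment> \<open>In the expansion around \<open>h \<theta>\<close> the cross term vanishes by
    \<open>ortho\<close> and the rest is nonnegative.\<close>
  have "twist \<psi> (phase \<theta>) (h \<theta>) \<le> twist \<psi> (phase \<theta>) k" for \<theta> k
    using twist_add[of \<psi> "phase \<theta>" "h \<theta>" 1 "\<lambda>v. k v - h \<theta> v"] ortho[of \<theta> "\<lambda>v. k v - h \<theta> v"]
      twist_nonneg[OF g, of "\<lambda>_. 0" "\<lambda>v. k v - h \<theta> v"] by simp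
  moreover have "transpose M = M"
    by (simp add: transpose_def M_def vec_eq_iff mult_ac)
  ultimately show ?thesis
    using quadM unfolding homogenized_def N_def by metis
qed

text \<open>As for the bands: the optimal \<open>h\<close> for \<open>\<psi>'\<close> is admissible
  for \<open>\<psi>\<close>, and conductances and norms compare with the same constants.\<close>

lemma homogenized_compare:
  assumes "ground q \<psi> \<mu>" "ground q' \<psi>' \<mu>'" "a > 0"
    and "\<And>v. v \<in> V \<Longrightarrow> a * \<psi>' v \<le> \<psi> v" "\<And>v. v \<in> V \<Longrightarrow> \<psi> v \<le> b * \<psi>' v"
    and M: "homogenized \<psi> M" "homogenized \<psi>' M'"
  shows "a\<^sup>2 * quad M \<theta> \<le> b\<^sup>2 * quad M' \<theta>"
proof -
  let ?N = "wl2 \<psi> (\<lambda>_. 1)" and ?N' = "wl2 \<psi>' (\<lambda>_. 1)"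
  have N: "?N > 0" "?N' > 0" using assms wl2_one_pos by blast+
  obtain h where h: "quad M' \<theta> * ?N' = twist \<psi>' (phase \<theta>) h"
    using M(2) unfolding homogenized_def by blast
  obtain k where k: "quad M \<theta> * ?N = twist \<psi> (phase \<theta>) k"
    using M(1) unfolding homogenized_def by blast
  have "quad M \<theta> * ?N \<ge> 0" unfolding k using twist_nonneg[OF assms(1)] .
  then have pos: "quad M \<theta> \<ge> 0" using N by (simp add: zero_le_mult_iff)
  have "(a\<^sup>2 * quad M \<theta>) * ?N' \<le> quad M \<theta> * ?N"
    using mult_left_mono[OF wl2_compare[OF assms(1-5), of "\<lambda>_. 1"] pos] by (simp add: mult_ac)
  also have "\<dots> \<le> twist \<psi> (phase \<theta>) h"
    using M(1) unfolding homogenized_def by blast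
  also have "\<dots> \<le> (\<Sum>e\<in>E. (b\<^sup>2 * cond \<psi>' e) * (phase \<theta> e + h (t e) - h (s e))\<^sup>2)"
    unfolding twist_def by (intro sum_mono mult_right_mono cond_compare[OF assms(1-5)]) auto
  also have "\<dots> = b\<^sup>2 * twist \<psi>' (phase \<theta>) h"
    by (simp add: twist_def sum_distrib_left mult.assoc)
  also have "\<dots> = (b\<^sup>2 * quad M' \<theta>) * ?N'" by (simp add: h[symmetric])
  finally show ?thesis using N by simp
qed

text \<open>Zero energy would make \<open>phase \<theta>\<close> the gradient of a function. A
  closed walk of index \<open>axis i 1\<close> then gives \<open>\<theta> $ i = 0\<close> for every
  \<open>i\<close>.\<close>

lemma homogenized_pos:
  assumes g: "ground q \<psi> \<mu>" and M: "homogenized \<psi> M" and "\<theta> \<noteq> 0"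
  shows "quad M \<theta> > 0"
proof (rule ccontr)
  assume neg: "\<not> quad M \<theta> > 0"
  obtain h where h: "quad M \<theta> * wl2 \<psi> (\<lambda>_. 1) = twist \<psi> (phase \<theta>) h"
    using M unfolding homogenized_def by blast
  have "twist \<psi> (phase \<theta>) h \<le> 0"
    unfolding h[symmetric] using neg wl2_one_pos[OF g] by (simp add: mult_le_0_iff)
  with twist_nonneg[OF g, of "phase \<theta>" h] have "twist \<psi> (phase \<theta>) h = 0" by linarith
  then have "\<forall>e\<in>E. cond \<psi> e * (phase \<theta> e + h (t e) - h (s e))\<^sup>2 = 0"
    unfolding twist_def using finite_E
    by (subst (asm) sum_nonneg_eq_0_iff) (auto intro!: mult_nonneg_nonneg intro: less_imp_le[OF cond_pos[OF g]])
  then have 0: "phase \<theta> e + h (t e) - h (s e) = 0" if "e \<in> E" for e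
    using that cond_pos[OF g that] by fastforce
  obtain z where z: "z \<in> V" using V_nonempty by blast
  have "\<theta> $ i = 0" for i
    using walk_potential[OF walks[OF z z, of "axis i 1"] 0] by (simp add: iprod_axis)
  then show False using assms(3) by (simp add: vec_eq_iff)
qed

text \<open>The trial function \<open>cis h\<close> with optimal \<open>h\<close> has modulus one,
  so its weighted norm is that of the constant 1. As a chord is at most its arc, the bound holds for
  all \<open>\<theta>\<close> without an error term.\<close>

lemma bottom_le_homogenized:
  assumes g: "ground q \<psi> \<mu>" and M: "homogenized \<psi> M"
  shows "bottom q (phase \<theta>) - \<mu> \<le> (1/2) * quad M \<theta>"
proof -
  obtain h where h: "quad M \<theta> * wl2 \<psi> (\<lambda>_. 1) = twist \<psi> (phase \<theta>) h"
    using M unfolding homogenized_def by blast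
  let ?g = "\<lambda>v. cis (h v)"
  have "cmod (?g (s e) - cis (phase \<theta> e) * ?g (t e)) \<le> \<bar>phase \<theta> e + h (t e) - h (s e)\<bar>" for e
  proof -
    have "?g (s e) - cis (phase \<theta> e) * ?g (t e) = cis (h (s e)) * (1 - cis (phase \<theta> e + h (t e) - h (s e)))"
      by (simp add: right_diff_distrib cis_mult)
    then show ?thesis using cmod_cis_minus_one by (simp add: norm_mult)
  qed
  then have "dirichlet \<psi> (phase \<theta>) ?g \<le> (1/2) * twist \<psi> (phase \<theta>) h"
    unfolding dirichlet_def twist_def
    by (intro mult_left_mono sum_mono) (auto simp: abs_le_square_iff[symmetric] intro: less_imp_le[OF cond_pos[OF g]])
  moreover have "wl2 \<psi> ?g = wl2 \<psi> (\<lambda>_. 1)" by (simp add: wl2_def)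
  ultimately have "(bottom q (phase \<theta>) - \<mu>) * wl2 \<psi> (\<lambda>_. 1) \<le> ((1/2) * quad M \<theta>) * wl2 \<psi> (\<lambda>_. 1)"
    using bottom_le_dirichlet[OF g antisymmetric_phase, of \<theta> ?g] h by simp
  then show ?thesis using wl2_one_pos[OF g] by simp
qed

text \<open>The choice \<open>h = 0\<close> in the minimization is enough.\<close>

lemma homogenized_bound:
  assumes g: "ground q \<psi> \<mu>" and M: "homogenized \<psi> M"
  shows "\<exists>C\<ge>0. \<forall>\<theta>. quad M \<theta> \<le> C * (norm \<theta>)\<^sup>2"
proof -
  obtain T where T: "T \<ge> 0" "\<And>e \<theta>. e \<in> E \<Longrightarrow> \<bar>phase \<theta> e\<bar> \<le> T * norm \<theta>"
    using phase_bound by blast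
  have N: "wl2 \<psi> (\<lambda>_. 1) > 0" using g by (rule wl2_one_pos)
  define C where "C = (\<Sum>e\<in>E. cond \<psi> e * T\<^sup>2) / wl2 \<psi> (\<lambda>_. 1)"
  have "quad M \<theta> \<le> C * (norm \<theta>)\<^sup>2" for \<theta>
  proof -
    have "quad M \<theta> * wl2 \<psi> (\<lambda>_. 1) \<le> twist \<psi> (phase \<theta>) (\<lambda>_. 0)"
      using M unfolding homogenized_def by blast
    also have "\<dots> \<le> (\<Sum>e\<in>E. cond \<psi> e * (T * norm \<theta>)\<^sup>2)"
      unfolding twist_def using T
      by (intro sum_mono mult_left_mono) (auto simp: abs_le_square_iff[symmetric] intro: less_imp_le[OF cond_pos[OF g]])
    also have "\<dots> = (\<Sum>e\<in>E. cond \<psi> e * T\<^sup>2) * (norm \<theta>)\<^sup>2"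
      by (simp only: power_mult_distrib sum_distrib_right mult.assoc)
    also have "\<dots> = C * (norm \<theta>)\<^sup>2 * wl2 \<psi> (\<lambda>_. 1)"
      using N by (simp add: C_def)
    finally show ?thesis using N by simp
  qed
  moreover have "C \<ge> 0"
    unfolding C_def using N by (intro divide_nonneg_nonneg sum_nonneg mult_nonneg_nonneg) (auto intro: less_imp_le[OF cond_pos[OF g]])
  ultimately show ?thesis by blast
qed

section \<open>Lower bound for the lowest band function near 0\<close>

text \<open>A constant unimodular factor changes neither norm nor energy. Making the value at
  \<open>z\<close> real is what will keep the imaginary part small.\<close>

lemma minimizer_phase:
  assumes "ground q \<psi> \<mu>" "antisymmetric \<alpha>"
  shows "\<exists>g. wl2 \<psi> g = 1 \<and> dirichlet \<psi> \<alpha> g = bottom q \<alpha> - \<mu> \<and> g z = of_real (cmod (g z))"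
proof -
  obtain g where g: "wl2 \<psi> g = 1" "dirichlet \<psi> \<alpha> g = bottom q \<alpha> - \<mu>"
    using bottom_attained[OF assms] by blast
  define c where "c = cis (- Arg (g z))"
  have c: "cmod c = 1" by (simp add: c_def)
  have "c * g z = of_real (cmod (g z))"
  proof -
    have "g z = of_real (cmod (g z)) * cis (Arg (g z))"
      by (metis rcis_cmod_Arg rcis_def)
    then have "c * g z = of_real (cmod (g z)) * (cis (Arg (g z)) * c)" by (metis mult.commute mult.left_commute)
    then show ?thesis by (simp add: c_def cis_mult)
  qed
  moreover have "wl2 \<psi> (\<lambda>v. c * g v) = 1"
    using g by (simp add: wl2_def norm_mult c)
  moreover have "dirichlet \<psi> \<alpha> (\<lambda>v. c * g v) = bottom q \<alpha> - \<mu>"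
  proof -
    have "cmod (c * g (s e) - cis (\<alpha> e) * (c * g (t e))) = cmod (g (s e) - cis (\<alpha> e) * g (t e))" for e
    proof -
      have "c * g (s e) - cis (\<alpha> e) * (c * g (t e)) = c * (g (s e) - cis (\<alpha> e) * g (t e))"
        by (simp add: algebra_simps)
      then show ?thesis by (simp add: norm_mult c)
    qed
    then show ?thesis using g by (simp add: dirichlet_def)
  qed
  ultimately show ?thesis
    by (intro exI[of _ "\<lambda>v. c * g v"]) (simp add: norm_mult c)
qed

lemma wl2_pointwise:
  assumes g: "ground q \<psi> \<mu>"
  shows "\<exists>G\<ge>0. \<forall>g. wl2 \<psi> g = 1 \<longrightarrow> (\<forall>v\<in>V. cmod (g v) \<le> G)"
proof -
  define G where "G = (\<Sum>v\<in>V. 1 / \<psi> v)"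
  have p: "\<psi> v > 0" if "v \<in> V" for v using that g by (simp add: ground_def)
  have "cmod (g v) \<le> G" if "wl2 \<psi> g = 1" "v \<in> V" for g v
  proof -
    have "(\<psi> v)\<^sup>2 * (cmod (g v))\<^sup>2 \<le> 1"
      unfolding that(1)[symmetric] wl2_def using finite_V that(2) by (intro member_le_sum) auto
    then have "(\<psi> v * cmod (g v))\<^sup>2 \<le> 1\<^sup>2" by (simp add: power_mult_distrib)
    then have "\<psi> v * cmod (g v) \<le> 1" using power2_le_imp_le zero_le_one by blast
    then have "cmod (g v) \<le> 1 / \<psi> v" using p[OF that(2)] by (simp add: field_simps)
    also have "\<dots> \<le> G" unfolding G_def using finite_V that p by (intro member_le_sum) (auto intro: less_imp_le)
    finally show ?thesis .
  qed
  moreover have "G \<ge> 0" unfolding G_def using p by (intro sum_nonneg) (auto intro: less_imp_le)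
  ultimately show ?thesis by blast
qed

text \<open>The upper bound makes the energy of the minimizer quadratically small in
  \<open>\<theta>\<close>, so its edge differences are linearly small, and
  \<open>oscillation\<close> brings it close to its value \<open>\<rho>\<close> at \<open>z\<close>.
  The constants \<open>B\<close> and \<open>G\<close> do not depend on
  \<open>\<theta>\<close>.\<close>

lemma minimizer_rigidity:
  assumes g: "ground q \<psi> \<mu>" and M: "homogenized \<psi> M" and z: "z \<in> V"
  shows "\<exists>B\<ge>0. \<exists>G\<ge>0. \<forall>\<theta>. \<exists>g \<rho>. wl2 \<psi> g = 1 \<and> dirichlet \<psi> (phase \<theta>) g = bottom q (phase \<theta>) - \<mu> \<and>
      0 \<le> \<rho> \<and> \<rho> \<le> G \<and> (\<forall>v\<in>V. cmod (g v) \<le> G \<and> cmod (g v - of_real \<rho>) \<le> B * norm \<theta>)"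
proof -
  obtain T where T: "T \<ge> 0" "\<And>e \<theta>. e \<in> E \<Longrightarrow> \<bar>phase \<theta> e\<bar> \<le> T * norm \<theta>"
    using phase_bound by blast
  obtain G where G: "G \<ge> 0" "\<And>g v. \<lbrakk>wl2 \<psi> g = 1; v \<in> V\<rbrakk> \<Longrightarrow> cmod (g v) \<le> G"
    using wl2_pointwise[OF g] by blast
  obtain C where C: "C \<ge> 0" "\<And>\<theta>. quad M \<theta> \<le> C * (norm \<theta>)\<^sup>2"
    using homogenized_bound[OF g M] by blast
  obtain K :: real where K: "K \<ge> 0"
    "\<And>(g :: 'v \<Rightarrow> complex) \<delta> u v. \<lbrakk>\<delta> \<ge> 0; \<forall>e\<in>E. norm (g (t e) - g (s e)) \<le> \<delta>; u \<in> V; v \<in> V\<rbrakk> \<Longrightarrow> norm (g v - g u) \<le> K * \<delta>"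
    using oscillation by metis
  define D where "D = (\<Sum>e\<in>E. sqrt (C / cond \<psi> e))"
  have cp: "cond \<psi> e > 0" if "e \<in> E" for e using cond_pos[OF g that] .
  have D: "D \<ge> 0" unfolding D_def using C(1) cp by (intro sum_nonneg) (auto intro!: divide_nonneg_pos)
  \<comment> \<open>\<open>D\<close> bounds the edge differences with phase, \<open>T * G\<close> is
    the cost of dropping the phase, and \<open>K\<close> passes from edges to arbitrary pairs of
    vertices.\<close>
  define B where "B = K * (D + T * G)"
  have B: "B \<ge> 0" unfolding B_def using K D T G by simp
  have "\<exists>g \<rho>. wl2 \<psi> g = 1 \<and> dirichlet \<psi> (phase \<theta>) g = bottom q (phase \<theta>) - \<mu> \<and>
      0 \<le> \<rho> \<and> \<rho> \<le> G \<and> (\<forall>v\<in>V. cmod (g v) \<le> G \<and> cmod (g v - of_real \<rho>) \<le> B * norm \<theta>)" for \<theta>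
  proof -
    obtain k where k: "wl2 \<psi> k = 1" "dirichlet \<psi> (phase \<theta>) k = bottom q (phase \<theta>) - \<mu>" "k z = of_real (cmod (k z))"
      using minimizer_phase[OF g antisymmetric_phase] by blast
    have dk: "dirichlet \<psi> (phase \<theta>) k \<le> (1/2) * (C * (norm \<theta>)\<^sup>2)"
      using k(2) bottom_le_homogenized[OF g M, of \<theta>] C(2)[of \<theta>] by linarith
    have "cmod (k (t e) - k (s e)) \<le> (D + T * G) * norm \<theta>" if e: "e \<in> E" for e
    proof -
      let ?z = "k (s e) - cis (phase \<theta> e) * k (t e)"
      have "cond \<psi> e * (cmod ?z)\<^sup>2 \<le> 2 * dirichlet \<psi> (phase \<theta>) k"
        unfolding dirichlet_def using e finite_E
        by (simp, intro member_le_sum) (auto intro!: mult_nonneg_nonneg intro: less_imp_le[OF cp])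
      also have "\<dots> \<le> C * (norm \<theta>)\<^sup>2" using dk by linarith
      finally have "(cmod ?z)\<^sup>2 \<le> (C / cond \<psi> e) * (norm \<theta>)\<^sup>2"
        using cp[OF e] by (simp add: field_simps)
      then have "cmod ?z \<le> sqrt ((C / cond \<psi> e) * (norm \<theta>)\<^sup>2)" by (rule real_le_rsqrt)
      also have "\<dots> = sqrt (C / cond \<psi> e) * norm \<theta>" by (simp only: real_sqrt_mult real_sqrt_abs abs_norm_cancel)
      also have "\<dots> \<le> D * norm \<theta>"
        unfolding D_def using e finite_E C(1) cp
        by (intro mult_right_mono member_le_sum) (auto intro!: divide_nonneg_pos)
      finally have 1: "cmod ?z \<le> D * norm \<theta>" .
      have "cmod ((1 - cis (phase \<theta> e)) * k (t e)) \<le> (T * norm \<theta>) * G"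
        unfolding norm_mult using T e G k(1) t_in
        by (intro mult_mono order_trans[OF cmod_cis_minus_one]) auto
      moreover have "k (t e) - k (s e) = (1 - cis (phase \<theta> e)) * k (t e) - ?z"
        by (simp add: algebra_simps)
      ultimately show ?thesis
        using 1 norm_triangle_ineq4[of "(1 - cis (phase \<theta> e)) * k (t e)" ?z] by (simp add: algebra_simps)
    qed
    then have "cmod (k v - k z) \<le> B * norm \<theta>" if "v \<in> V" for v
      using K(2)[of "(D + T * G) * norm \<theta>" k z v] that z D T G by (simp add: B_def mult.assoc)
    then show ?thesis using k G(2)[OF k(1)] z
      by (intro exI[of _ k] exI[of _ "cmod (k z)"]) auto
  qed
  then show ?thesis using B G(1) by blast
qed

text \<open>The minimizer \<open>k\<close> is near the real constant \<open>\<rho>\<close>, so its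
  imaginary part \<open>y\<close> serves as \<open>h\<close> for the scaled parameter
  \<open>\<rho> *\<^sub>R \<theta>\<close>. This yields
  \<open>\<rho>\<^sup>2 * quad M \<theta>\<close>, and the normalization of \<open>k\<close> makes
  \<open>\<rho>\<^sup>2 * N\<close> at least 1 up to a linear error.\<close>

lemma homogenized_le_bottom:
  assumes g: "ground q \<psi> \<mu>" and M: "homogenized \<psi> M"
  shows "\<exists>C\<ge>0. \<forall>\<theta>. (1/2) * quad M \<theta> - C * norm \<theta> ^ 3 \<le> bottom q (phase \<theta>) - \<mu>"
proof -
  obtain z where z: "z \<in> V" using V_nonempty by blast
  obtain T where T: "T \<ge> 0" "\<And>e \<theta>. e \<in> E \<Longrightarrow> \<bar>phase \<theta> e\<bar> \<le> T * norm \<theta>"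
    using phase_bound by blast
  obtain B G where BG: "B \<ge> 0" "G \<ge> 0"
    and min: "\<And>\<theta>. \<exists>g \<rho>. wl2 \<psi> g = 1 \<and> dirichlet \<psi> (phase \<theta>) g = bottom q (phase \<theta>) - \<mu> \<and>
      0 \<le> \<rho> \<and> \<rho> \<le> G \<and> (\<forall>v\<in>V. cmod (g v) \<le> G \<and> cmod (g v - of_real \<rho>) \<le> B * norm \<theta>)"
    using minimizer_rigidity[OF g M z] by metis
  obtain C where C: "C \<ge> 0" "\<And>\<theta>. quad M \<theta> \<le> C * (norm \<theta>)\<^sup>2"
    using homogenized_bound[OF g M] by blast
  define N where "N = wl2 \<psi> (\<lambda>_. 1)"
  have N: "N > 0" unfolding N_def using g by (rule wl2_one_pos)
  define A where "A = (\<Sum>e\<in>E. cond \<psi> e)"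
  have cp: "cond \<psi> e > 0" if "e \<in> E" for e using cond_pos[OF g that] .
  have A: "A \<ge> 0" unfolding A_def using cp by (intro sum_nonneg) (auto intro: less_imp_le)
  \<comment> \<open>\<open>R\<close> bounds the quadratic linearization error \<open>r\<close> on an
    edge, and \<open>Z\<close> the linear main term \<open>\<zeta>\<close>; their product is of
    third order.\<close>
  define R where "R = 2 * T * B + T\<^sup>2 * G"
  define Z where "Z = G * T + 2 * B"
  have RZ: "R \<ge> 0" "Z \<ge> 0" using T BG by (auto simp: R_def Z_def)
  \<comment> \<open>The first summand pays for the cross terms of \<open>\<zeta>\<close> and
    \<open>r\<close>, the second for the error in the normalization.\<close>
  define C' where "C' = A * Z * R + C * B * G * N"
  have "(1/2) * quad M \<theta> - C' * norm \<theta> ^ 3 \<le> bottom q (phase \<theta>) - \<mu>" for \<theta>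
  proof -
    let ?n = "norm \<theta>"
    have qpos: "quad M \<theta> \<ge> 0"
      using homogenized_pos[OF g M, of \<theta>] by (cases "\<theta> = 0") (auto simp: quad_def)
    obtain k \<rho> where k: "wl2 \<psi> k = 1" "dirichlet \<psi> (phase \<theta>) k = bottom q (phase \<theta>) - \<mu>"
      "0 \<le> \<rho>" "\<rho> \<le> G" and kv: "\<And>v. v \<in> V \<Longrightarrow> cmod (k v) \<le> G" "\<And>v. v \<in> V \<Longrightarrow> cmod (k v - of_real \<rho>) \<le> B * ?n"
      using min[of \<theta>] by blast
    define y where "y v = Im (k v)" for v
    define x where "x v = Re (k v)" for v
    have y: "\<bar>y v\<bar> \<le> B * ?n" if "v \<in> V" for v
      using abs_Im_le_cmod[of "k v - of_real \<rho>"] kv(2)[OF that] by (simp add: y_def)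
    have x: "\<bar>x v - \<rho>\<bar> \<le> B * ?n" if "v \<in> V" for v
      using abs_Re_le_cmod[of "k v - of_real \<rho>"] kv(2)[OF that] by (simp add: x_def)
    have xG: "\<bar>x v\<bar> \<le> G" if "v \<in> V" for v
      using abs_Re_le_cmod[of "k v"] kv(1)[OF that] by (simp add: x_def)
    \<comment> \<open>Only the imaginary part of the difference is kept; it is
      \<open>- (\<zeta> + r)\<close>, and the square of \<open>r\<close> is dropped after
      expanding.\<close>
    have edge: "(phase (\<rho> *\<^sub>R \<theta>) e + y (t e) - y (s e))\<^sup>2 - 2 * (Z * R) * ?n ^ 3
        \<le> (cmod (k (s e) - cis (phase \<theta> e) * k (t e)))\<^sup>2" if e: "e \<in> E" for e
    proof -
      let ?a = "phase \<theta> e"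
      define \<zeta> where "\<zeta> = phase (\<rho> *\<^sub>R \<theta>) e + y (t e) - y (s e)"
      \<comment> \<open>The three errors come from replacing \<open>cos\<close> by 1,
        \<open>sin\<close> by its argument and the real part of \<open>k\<close> by
        \<open>\<rho>\<close>; each is of second order.\<close>
      define r where "r = (cos ?a - 1) * y (t e) + (sin ?a - ?a) * x (t e) + ?a * (x (t e) - \<rho>)"
      have a: "\<bar>?a\<bar> \<le> T * ?n" using T e by blast
      have \<zeta>: "\<zeta> = \<rho> * ?a + y (t e) - y (s e)"
        by (simp add: \<zeta>_def phase_def iprod_simps)
      have im: "Im (k (s e) - cis ?a * k (t e)) = - (\<zeta> + r)"
        by (simp add: \<zeta> r_def x_def y_def algebra_simps)
      have "\<bar>cos ?a - 1\<bar> \<le> T * ?n"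
        using abs_Re_le_cmod[of "1 - cis ?a"] cmod_cis_minus_one[of ?a] a by simp
      then have r1: "\<bar>(cos ?a - 1) * y (t e)\<bar> \<le> (T * ?n) * (B * ?n)"
        unfolding abs_mult using y[OF t_in[OF e]] T by (intro mult_mono) auto
      have "\<bar>sin ?a - ?a\<bar> \<le> (T * ?n)\<^sup>2"
        using abs_sin_minus_self[of ?a] a T by (meson abs_le_square_iff abs_ge_self order_trans)
      then have r2: "\<bar>(sin ?a - ?a) * x (t e)\<bar> \<le> (T * ?n)\<^sup>2 * G"
        unfolding abs_mult using xG[OF t_in[OF e]] by (intro mult_mono) auto
      have r3: "\<bar>?a * (x (t e) - \<rho>)\<bar> \<le> (T * ?n) * (B * ?n)"
        unfolding abs_mult using x[OF t_in[OF e]] a T by (intro mult_mono) auto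
      have "\<bar>r\<bar> \<le> (T * ?n) * (B * ?n) + (T * ?n)\<^sup>2 * G + (T * ?n) * (B * ?n)"
        unfolding r_def using r1 r2 r3 by linarith
      also have "\<dots> = R * ?n\<^sup>2" by (simp add: R_def power2_eq_square algebra_simps)
      finally have r: "\<bar>r\<bar> \<le> R * ?n\<^sup>2" .
      have "\<bar>\<rho> * ?a\<bar> \<le> G * (T * ?n)"
        unfolding abs_mult using k(3,4) a BG by (intro mult_mono) auto
      then have \<zeta>Z: "\<bar>\<zeta>\<bar> \<le> Z * ?n"
        using y[OF t_in[OF e]] y[OF s_in[OF e]] by (simp add: \<zeta> Z_def algebra_simps)
      have "\<bar>\<zeta> * r\<bar> \<le> (Z * ?n) * (R * ?n\<^sup>2)"
        unfolding abs_mult using r \<zeta>Z RZ by (intro mult_mono) auto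
      then have "- (\<zeta> * r) \<le> Z * R * ?n ^ 3"
        by (simp add: power2_eq_square power3_eq_cube mult_ac abs_le_iff)
      moreover have "2 * (Z * R) * ?n ^ 3 = 2 * (Z * R * ?n ^ 3)" by (simp only: mult.assoc)
      ultimately have "\<zeta>\<^sup>2 - 2 * (Z * R) * ?n ^ 3 \<le> \<zeta>\<^sup>2 + 2 * (\<zeta> * r)" by linarith
      also have "\<dots> \<le> (\<zeta> + r)\<^sup>2" by (simp add: power2_sum)
      also have "\<dots> = (Im (k (s e) - cis ?a * k (t e)))\<^sup>2" unfolding im power2_minus ..
      also have "\<dots> \<le> (cmod (k (s e) - cis ?a * k (t e)))\<^sup>2"
        by (simp add: cmod_power2)
      finally show ?thesis by (simp add: \<zeta>_def)
    qed
    have "\<rho>\<^sup>2 * quad M \<theta> * N = quad M (\<rho> *\<^sub>R \<theta>) * N" by (simp add: quad_scale)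
    also have "\<dots> \<le> twist \<psi> (phase (\<rho> *\<^sub>R \<theta>)) y"
      using M unfolding homogenized_def N_def by blast
    finally have tw: "\<rho>\<^sup>2 * quad M \<theta> * N \<le> twist \<psi> (phase (\<rho> *\<^sub>R \<theta>)) y" .
    have "twist \<psi> (phase (\<rho> *\<^sub>R \<theta>)) y - A * (2 * (Z * R) * ?n ^ 3)
        = (\<Sum>e\<in>E. cond \<psi> e * ((phase (\<rho> *\<^sub>R \<theta>) e + y (t e) - y (s e))\<^sup>2 - 2 * (Z * R) * ?n ^ 3))"
      by (simp add: twist_def A_def right_diff_distrib sum_subtractf sum_distrib_right)
    also have "\<dots> \<le> 2 * dirichlet \<psi> (phase \<theta>) k"
      unfolding dirichlet_def using edge cp
      by (simp, intro sum_mono mult_left_mono) (auto intro: less_imp_le)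
    finally have "twist \<psi> (phase (\<rho> *\<^sub>R \<theta>)) y - A * (2 * (Z * R) * ?n ^ 3) \<le> 2 * (bottom q (phase \<theta>) - \<mu>)"
      unfolding k(2) .
    with diff_right_mono[OF tw]
    have dir: "\<rho>\<^sup>2 * quad M \<theta> * N - A * (2 * (Z * R) * ?n ^ 3) \<le> 2 * (bottom q (phase \<theta>) - \<mu>)"
      by (rule order_trans)
    \<comment> \<open>The lower bound on \<open>\<rho>\<close>: factor the difference of the squares
      of \<open>cmod (k v)\<close> and \<open>\<rho>\<close> and use rigidity on one factor,
      boundedness on the other.\<close>
    have "1 \<le> (\<rho>\<^sup>2 + 2 * B * G * ?n) * N"
    proof -
      have "(cmod (k v))\<^sup>2 \<le> \<rho>\<^sup>2 + 2 * B * G * ?n" if "v \<in> V" for v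
      proof -
        have "cmod (k v) - \<rho> \<le> B * ?n"
          using norm_triangle_ineq2[of "k v" "of_real \<rho>"] kv(2)[OF that] k(3) by simp
        then have "(cmod (k v) - \<rho>) * (cmod (k v) + \<rho>) \<le> (B * ?n) * (cmod (k v) + \<rho>)"
          using k(3) by (intro mult_right_mono) auto
        also have "\<dots> \<le> (B * ?n) * (2 * G)"
          using kv(1)[OF that] k(4) BG by (intro mult_left_mono) auto
        finally show ?thesis by (simp add: power2_eq_square algebra_simps)
      qed
      then have "wl2 \<psi> k \<le> (\<Sum>v\<in>V. (\<psi> v)\<^sup>2 * (\<rho>\<^sup>2 + 2 * B * G * ?n))"
        unfolding wl2_def by (intro sum_mono mult_left_mono) auto
      also have "\<dots> = (\<rho>\<^sup>2 + 2 * B * G * ?n) * N"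
        by (simp add: N_def wl2_def sum_distrib_right[symmetric])
      finally show ?thesis using k(1) by simp
    qed
    \<comment> \<open>The linear error in the normalization meets a quadratic form of order two, so
      it too becomes cubic.\<close>
    from mult_left_mono[OF this qpos]
    have "quad M \<theta> \<le> \<rho>\<^sup>2 * quad M \<theta> * N + quad M \<theta> * (2 * B * G * ?n * N)"
      by (simp add: algebra_simps)
    also have "quad M \<theta> * (2 * B * G * ?n * N) \<le> (C * ?n\<^sup>2) * (2 * B * G * ?n * N)"
      using C(2)[of \<theta>] BG N by (intro mult_right_mono) auto
    also have "\<dots> = 2 * (C * B * G * N) * ?n ^ 3"
      by (simp add: power2_eq_square power3_eq_cube)
    finally have "quad M \<theta> - 2 * (C * B * G * N) * ?n ^ 3 \<le> \<rho>\<^sup>2 * quad M \<theta> * N" by linarith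
    with dir have "quad M \<theta> - 2 * (C * B * G * N) * ?n ^ 3 - A * (2 * (Z * R) * ?n ^ 3) \<le> 2 * (bottom q (phase \<theta>) - \<mu>)"
      by linarith
    moreover have "2 * (C' * ?n ^ 3) = 2 * (C * B * G * N) * ?n ^ 3 + A * (2 * (Z * R) * ?n ^ 3)"
      by (simp add: C'_def algebra_simps)
    moreover have "(1/2) * a - e \<le> d" if "a - b - c \<le> 2 * d" "2 * e = b + c" for a b c d e :: real
      using that by linarith
    ultimately show ?thesis by blast
  qed
  moreover have "C' \<ge> 0" unfolding C'_def using A RZ C BG N by simp
  ultimately show ?thesis by blast
qed

lemma homogenized_expansion:
  assumes g: "ground q \<psi> \<mu>" and M: "homogenized \<psi> M"
  shows "second_order_expansion (\<lambda>\<theta>. bottom q (phase \<theta>)) M"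
proof -
  obtain C where C: "C \<ge> 0" "\<And>\<theta>. (1/2) * quad M \<theta> - C * norm \<theta> ^ 3 \<le> bottom q (phase \<theta>) - \<mu>"
    using homogenized_le_bottom[OF g M] by blast
  have "\<bar>bottom q (phase \<theta>) - \<mu> - (1/2) * quad M \<theta>\<bar> \<le> C * norm \<theta> ^ 3" for \<theta>
  proof -
    have "0 \<le> C * norm \<theta> ^ 3" using C(1) by simp
    then show ?thesis using C(2)[of \<theta>] bottom_le_homogenized[OF g M, of \<theta>] by linarith
  qed
  then have "(\<lambda>\<theta>. bottom q (phase \<theta>) - \<mu> - (1/2) * quad M \<theta>) \<in> O[at 0](\<lambda>\<theta>. norm \<theta> ^ 3)"
    by (intro bigoI[where c = C] always_eventually) auto
  moreover have "bottom q (phase 0) = \<mu>" by (simp add: phase_0 bottom_ground[OF g])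
  ultimately show ?thesis
    using M by (simp add: second_order_expansion_def quad_def homogenized_def)
qed

end

section \<open>Inverses of positive definite matrices\<close>

lemma invertible_of_quad_pos:
  assumes "\<And>x. x \<noteq> 0 \<Longrightarrow> quad M x > 0"
  shows "invertible M"
proof -
  have "x = 0" if "M *v x = 0" for x
    using assms[of x] that by (auto simp: quad_inner)
  then show ?thesis
    by (simp add: invertible_left_inverse matrix_left_invertible_ker)
qed

lemma matrix_inv_vector:
  fixes M :: "real^'d^'d"
  assumes "invertible M"
  shows "M *v (matrix_inv M *v x) = x"
proof -
  have "M ** matrix_inv M = mat 1"
    using someI_ex[OF assms[unfolded invertible_def]] by (simp add: matrix_inv_def)
  then show ?thesis by (simp add: matrix_vector_mul_assoc)
qed

lemma inner_symmetric_matrix: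
  fixes M :: "real^'d^'d"
  assumes "transpose M = M"
  shows "x \<bullet> (M *v y) = (M *v x) \<bullet> y"
  using dot_lmul_matrix[of x M y] assms by (metis transpose_matrix_vector)

text \<open>Expand the nonnegative form of \<open>A\<close> at \<open>c A\<^sup>-\<^sup>1 x - B\<^sup>-\<^sup>1 x\<close>.\<close>

lemma quad_inverse_antimono:
  fixes A B :: "real^'d^'d"
  assumes A: "transpose A = A" "\<And>x. x \<noteq> 0 \<Longrightarrow> quad A x > 0"
    and B: "\<And>x. x \<noteq> 0 \<Longrightarrow> quad B x > 0"
    and le: "\<And>x. quad A x \<le> c * quad B x" and c: "c > 0"
  shows "x \<bullet> (matrix_inv B *v x) \<le> c * (x \<bullet> (matrix_inv A *v x))"
proof -
  define u where "u = matrix_inv A *v x"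
  define y where "y = matrix_inv B *v x"
  have Au: "A *v u = x" and By: "B *v y = x"
    using A(2) B by (simp_all add: u_def y_def matrix_inv_vector invertible_of_quad_pos)
  have "0 \<le> quad A (c *\<^sub>R u - y)"
    using A(2)[of "c *\<^sub>R u - y"] by (cases "c *\<^sub>R u - y = 0") (auto simp: quad_def)
  also have "\<dots> = c\<^sup>2 * (x \<bullet> u) - 2 * c * (x \<bullet> y) + quad A y"
    using inner_symmetric_matrix[OF A(1), of u y]
    by (simp add: quad_inner matrix_vector_mult_diff_distrib matrix_vector_mult_scaleR Au
        inner_diff_left inner_diff_right inner_commute power2_eq_square algebra_simps)
  also have "\<dots> \<le> c\<^sup>2 * (x \<bullet> u) - 2 * c * (x \<bullet> y) + c * (x \<bullet> y)"
    using le[of y] By by (simp add: quad_inner inner_commute)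
  also have "\<dots> = c * (c * (x \<bullet> u) - x \<bullet> y)"
    by (simp add: power2_eq_square algebra_simps)
  finally show ?thesis using c by (simp add: zero_le_mult_iff u_def y_def)
qed

lemma Sup_range_compare:
  fixes F G :: "'b \<Rightarrow> real"
  assumes "bdd_above (range G)" "c \<ge> 0" "\<And>x. F x - \<mu> \<le> c * (G x - \<nu>)"
  shows "Sup (range F) - \<mu> \<le> c * (Sup (range G) - \<nu>)"
proof -
  have "F x \<le> \<mu> + c * (Sup (range G) - \<nu>)" for x
  proof -
    have "c * (G x - \<nu>) \<le> c * (Sup (range G) - \<nu>)"
      using assms by (intro mult_left_mono diff_right_mono cSup_upper) auto
    then show ?thesis using assms(3)[of x] by linarith
  qed
  then have "Sup (range F) \<le> \<mu> + c * (Sup (range G) - \<nu>)" by (intro cSup_least) auto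
  then show ?thesis by linarith
qed

section \<open>The quotient of a periodic graph\<close>

locale periodic_graph_fiber =
  fixes src tgt :: "'a \<Rightarrow> 'v" and rv :: "'a \<Rightarrow> 'a"
    and actv :: "int^'d \<Rightarrow> 'v \<Rightarrow> 'v" and acte :: "int^'d \<Rightarrow> 'a \<Rightarrow> 'a"
    and V0 :: "'v set"
  assumes pg: "periodic_graph src tgt rv actv acte"
    and tr: "tree_representatives src tgt actv V0"
begin

abbreviation "bs \<equiv> base actv V0"
abbreviation "cd \<equiv> coord actv V0"

lemma rv: "rv (rv e) = e" "src (rv e) = tgt e" "tgt (rv e) = src e"
  and act: "actv 0 v = v" "actv (m + n) v = actv m (actv n v)"
    "acte 0 e = e" "acte (m + n) e = acte m (acte n e)"
  and equivariant: "src (acte m e) = actv m (src e)" "tgt (acte m e) = actv m (tgt e)" "rv (acte m e) = acte m (rv e)"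
  and finite_out: "finite {e. src e = v}"
  and finite_orbits: "finite (range (\<lambda>v. range (\<lambda>m. actv m v)))"
  and connected: "(\<lambda>x y. \<exists>e. src e = x \<and> tgt e = y)\<^sup>*\<^sup>* u v"
  using pg unfolding periodic_graph_def by simp_all

lemma free: "actv m v = v \<Longrightarrow> m = 0"
  using pg unfolding periodic_graph_def by (elim conjE) blast

lemma act_inverse: "actv (- m) (actv m v) = v" "actv m (actv (- m) v) = v" "acte (- m) (acte m e) = e" "acte m (acte (- m) e) = e"
  using act by (metis add.left_inverse add.right_inverse)+

lemma representative: "\<exists>v0\<in>V0. \<exists>m. v = actv m v0"
  and representative_unique: "\<lbrakk>v0 \<in> V0; v1 \<in> V0; actv m v0 = actv n v1\<rbrakk> \<Longrightarrow> v0 = v1 \<and> m = n"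
proof -
  have ex1: "\<exists>!p. fst p \<in> V0 \<and> v = actv (snd p) (fst p)" for v
    using tr by (simp add: tree_representatives_def)
  then show "\<exists>v0\<in>V0. \<exists>m. v = actv m v0" by blast
  assume "v0 \<in> V0" "v1 \<in> V0" "actv m v0 = actv n v1"
  with ex1[of "actv m v0"] have "(v0, m) = (v1, n)" by (metis fst_conv snd_conv)
  then show "v0 = v1 \<and> m = n" by simp
qed

lemma base_coord: "v0 \<in> V0 \<Longrightarrow> bs (actv m v0) = v0" "v0 \<in> V0 \<Longrightarrow> cd (actv m v0) = m"
  unfolding base_def coord_def by (rule the_equality; use representative_unique in blast)+

lemma base_in: "bs v \<in> V0" and act_coord_base: "actv (cd v) (bs v) = v"
  using representative[of v] base_coord by auto

lemma base_coord_act: "bs (actv n v) = bs v" "cd (actv n v) = n + cd v"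
proof -
  have "actv n v = actv (n + cd v) (bs v)" by (simp add: act act_coord_base)
  then show "bs (actv n v) = bs v" "cd (actv n v) = n + cd v" using base_coord base_in by simp_all
qed

lemma base_coord_rep: "v \<in> V0 \<Longrightarrow> bs v = v" "v \<in> V0 \<Longrightarrow> cd v = 0"
  using base_coord[of v 0] by (simp_all add: act)

lemma finite_V0: "finite V0"
proof (rule finite_imageD)
  show "finite ((\<lambda>v. range (\<lambda>m. actv m v)) ` V0)"
    by (rule finite_subset[OF _ finite_orbits]) auto
  show "inj_on (\<lambda>v. range (\<lambda>m. actv m v)) V0"
  proof (rule inj_onI)
    fix u v assume uv: "u \<in> V0" "v \<in> V0" "range (\<lambda>m. actv m u) = range (\<lambda>m. actv m v)"
    have "u \<in> range (\<lambda>m. actv m u)" by (rule range_eqI[of _ _ 0]) (simp add: act)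
    then obtain m where "u = actv m v" using uv(3) by auto
    then show "u = v" using base_coord_act(1)[of m v] uv base_coord_rep by metis
  qed
qed

lemma degree_act: "degree src (actv m v) = degree src v"
proof -
  have "bij_betw (acte m) {e. src e = v} {e. src e = actv m v}"
    by (rule bij_betw_byWitness[where f' = "acte (- m)"]) (auto simp: act_inverse equivariant)
  then show ?thesis by (simp add: degree_def bij_betw_same_card)
qed

lemma degree_base: "degree src (bs v) = degree src v"
  using degree_act[of "cd v" "bs v"] by (simp add: act_coord_base)

text \<open>By freeness a nonzero translate of \<open>v\<close> is a different vertex, so a path
  from \<open>v\<close> to it has a first edge.\<close>

lemma degree_pos: "degree src v > 0"
proof -
  have "(axis undefined 1 :: int^'d) \<noteq> 0" by (simp add: axis_eq_0_iff)
  then have "actv (axis undefined 1) v \<noteq> v" using free by blast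
  with connected[of v "actv (axis undefined 1) v"] have "\<exists>e. src e = v"
    by (cases rule: converse_rtranclpE) auto
  then have "{e. src e = v} \<noteq> {}" by blast
  then show ?thesis using finite_out by (simp add: degree_def card_gt_0_iff)
qed

text \<open>Each orbit of oriented edges has exactly one member starting in \<open>V0\<close>, which
  represents the quotient edge.\<close>

definition "edges \<equiv> {e. src e \<in> V0}"
text \<open>The reversed edge starts at \<open>tgt e\<close>, possibly outside \<open>V0\<close>;
  the translation carries it back to the representative.\<close>

definition "opposite e \<equiv> acte (- cd (tgt e)) (rv e)"
definition "weight e \<equiv> 1 / sqrt (degree src (src e) * degree src (tgt e))"

abbreviation "index \<equiv> edge_index src tgt actv V0"

lemma index_act: "index (acte m e) = index e"
  by (simp add: edge_index_def equivariant base_coord_act)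

text \<open>Each edge of the path is translated to start in \<open>V0\<close>. Its index is the
  increment of the coordinate, so the indices telescope from 0 at \<open>u\<close> to
  \<open>cd y\<close>.\<close>

lemma walk_lift:
  assumes "(\<lambda>x y. \<exists>e. src e = x \<and> tgt e = y)\<^sup>*\<^sup>* u y" "u \<in> V0"
  shows "walk edges src (\<lambda>e. bs (tgt e)) index u (bs y) (cd y)"
  using assms(1)
proof induction
  case base
  show ?case using assms(2) by (simp add: base_coord_rep walk_refl)
next
  case (step y z)
  then obtain e where e: "src e = y" "tgt e = z" by blast
  define e' where "e' = acte (- cd y) e"
  have src': "src e' = bs y"
    using act_inverse(1)[of "cd y" "bs y"] by (simp add: e'_def equivariant e act_coord_base)
  have "e' \<in> edges" by (simp add: edges_def src' base_in)
  from walk_step[OF step.IH this src']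
  have "walk edges src (\<lambda>e. bs (tgt e)) index u (bs (tgt e')) (cd y + index e')" .
  moreover have "bs (tgt e') = bs z" by (simp add: e'_def equivariant e base_coord_act)
  moreover have "index e' = cd z - cd y" by (simp add: e'_def index_act) (simp add: edge_index_def e)
  ultimately show ?case by simp
qed

sublocale quotient_graph V0 edges src "\<lambda>e. bs (tgt e)" opposite weight index
proof
  show "finite V0" by (rule finite_V0)
  show "V0 \<noteq> {}" using base_in by blast
  have "edges = (\<Union>v\<in>V0. {e. src e = v})" by (auto simp: edges_def)
  then show "finite edges" using finite_V0 finite_out by simp
next
  fix e assume e: "e \<in> edges"
  then show "src e \<in> V0" by (simp add: edges_def)
  then have ce: "cd (src e) = 0" by (simp add: base_coord_rep)
  show s: "src (opposite e) = bs (tgt e)"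
    using act_inverse(1)[of "cd (tgt e)" "bs (tgt e)"]
    by (simp add: opposite_def equivariant rv act_coord_base)
  then show "opposite e \<in> edges" by (simp add: edges_def base_in)
  have t: "tgt (opposite e) = actv (- cd (tgt e)) (src e)"
    by (simp add: opposite_def equivariant rv)
  then have ct: "cd (tgt (opposite e)) = - cd (tgt e)"
    using ce by (simp add: base_coord_act)
  show "opposite (opposite e) = e"
    unfolding opposite_def[of "opposite e"] ct by (simp add: opposite_def equivariant rv act_inverse)
  show "weight e > 0" by (simp add: weight_def degree_pos)
  show "weight (opposite e) = weight e"
    unfolding weight_def s t degree_base degree_act by (simp add: mult.commute)
  show "index (opposite e) = - index e"
    unfolding edge_index_def ct s using ce by (simp add: base_coord_rep base_in)
next
  fix u v m assume "u \<in> V0" "v \<in> V0"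
  \<comment> \<open>A path in the periodic graph from \<open>u\<close> to the translate of
    \<open>v\<close> by \<open>m\<close> projects to a walk of total index \<open>m\<close>.\<close>
  then show "walk edges src (\<lambda>e. bs (tgt e)) index u v m"
    using walk_lift[OF connected, of u "actv m v"] by (simp add: base_coord)
qed

text \<open>The identity part of the Laplacian is absorbed into the potential.\<close>

lemma fiber_op_eq_magnetic:
  assumes "v \<in> V0"
  shows "fiber_op src tgt actv V0 Q \<theta> f v = magnetic (\<lambda>v. 1 + Q v) (phase \<theta>) f v"
proof -
  have "{e \<in> edges. src e = v} = {e. src e = v}" using assms by (auto simp: edges_def)
  then show ?thesis
    unfolding fiber_op_def magnetic_def phase_def
    by (simp add: weight_def algebra_simps)
qed

lemma is_eigenvector_iff:
  "is_eigenvector src tgt actv V0 Q \<theta> \<mu> f \<longleftrightarrow> eigenvec (\<lambda>v. 1 + Q v) (phase \<theta>) \<mu> f"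
  by (simp add: is_eigenvector_def eigenvec_def fiber_op_eq_magnetic)

lemma lambda1_eq_bottom: "lambda1 src tgt actv V0 Q \<theta> = bottom (\<lambda>v. 1 + Q v) (phase \<theta>)"
  by (simp add: lambda1_def fiber_eigenvalues_def bottom_def is_eigenvector_iff)

text \<open>Each of the \<open>degree src v\<close> outgoing edges contributes
  \<open>1 / sqrt (degree src v)\<close>, which balances the diagonal term. The potential is written
  \<open>1 + 0\<close> to match \<open>1 + Q v\<close> for zero \<open>Q\<close>.\<close>

lemma laplacian_ground: "ground (\<lambda>v. 1 + 0) (\<lambda>v. sqrt (degree src v)) 0"
proof -
  have "(\<Sum>e\<in>{e \<in> edges. src e = v}. weight e * sqrt (degree src (bs (tgt e)))) = sqrt (degree src v)"
    if "v \<in> V0" for v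
  proof -
    have "(\<Sum>e\<in>{e \<in> edges. src e = v}. weight e * sqrt (degree src (bs (tgt e)))) =
        (\<Sum>e\<in>{e. src e = v}. 1 / sqrt (degree src v))"
    proof (rule sum.cong)
      show "{e \<in> edges. src e = v} = {e. src e = v}" using that by (auto simp: edges_def)
    next
      fix e assume "e \<in> {e. src e = v}"
      moreover have "sqrt (degree src (tgt e)) \<noteq> 0" using degree_pos[of "tgt e"] by simp
      ultimately show "weight e * sqrt (degree src (bs (tgt e))) = 1 / sqrt (degree src v)"
        by (simp add: weight_def degree_base real_sqrt_mult)
    qed
    also have "\<dots> = degree src v / sqrt (degree src v)" by (simp add: degree_def)
    also have "\<dots> = sqrt (degree src v)" using degree_pos[of v] by (simp add: real_div_sqrt)
    finally show ?thesis .
  qed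
  then show ?thesis by (simp add: ground_def degree_pos)
qed

section \<open>Band edges and effective masses\<close>

lemma Inf_band: "ground (\<lambda>v. 1 + Q v) \<psi> \<mu> \<Longrightarrow> Inf (band1 src tgt actv V0 Q) = \<mu>"
  unfolding band1_def
  by (rule cInf_eq_minimum)
    (auto simp: lambda1_eq_bottom bottom_ground phase_0 bottom_ge antisymmetric_phase intro!: range_eqI[of _ _ 0])

lemma bdd_above_band: "ground (\<lambda>v. 1 + Q v) \<psi> \<mu> \<Longrightarrow> bdd_above (band1 src tgt actv V0 Q)"
  using bottom_bounded antisymmetric_phase unfolding band1_def bdd_above_def
  by (force simp: lambda1_eq_bottom)

lemma band_nondegenerate:
  assumes "ground (\<lambda>v. 1 + Q v) \<psi> \<mu>"
  shows "\<mu> < Sup (band1 src tgt actv V0 Q)"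
proof -
  \<comment> \<open>Any parameter with some coordinate equal to 1 would serve.\<close>
  have "\<mu> < lambda1 src tgt actv V0 Q (\<chi> i. 1)"
    unfolding lambda1_eq_bottom by (rule bottom_nonconstant[OF assms]) simp
  also have "\<dots> \<le> Sup (band1 src tgt actv V0 Q)"
    using bdd_above_band[OF assms] by (intro cSup_upper) (auto simp: band1_def)
  finally show ?thesis .
qed

text \<open>The lower band edges are \<open>\<mu>\<close> and \<open>\<mu>'\<close>, so the
  pointwise comparison of the band functions passes to the suprema.\<close>

lemma band_length_compare:
  assumes "ground (\<lambda>v. 1 + Q v) \<psi> \<mu>" "ground (\<lambda>v. 1 + Q' v) \<psi>' \<mu>'" "a > 0"
    and "\<And>v. v \<in> V0 \<Longrightarrow> a * \<psi>' v \<le> \<psi> v" "\<And>v. v \<in> V0 \<Longrightarrow> \<psi> v \<le> b * \<psi>' v"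
  shows "band_length (band1 src tgt actv V0 Q) \<le> (b / a)\<^sup>2 * band_length (band1 src tgt actv V0 Q')"
proof -
  have "lambda1 src tgt actv V0 Q \<theta> - \<mu> \<le> (b / a)\<^sup>2 * (lambda1 src tgt actv V0 Q' \<theta> - \<mu>')" for \<theta>
    using bottom_compare[OF assms antisymmetric_phase, of \<theta>] assms(3)
    by (simp add: lambda1_eq_bottom power_divide field_simps)
  from Sup_range_compare[OF _ _ this] show ?thesis
    using bdd_above_band[OF assms(2)] Inf_band[OF assms(1)] Inf_band[OF assms(2)]
    by (simp add: band_length_def band1_def)
qed

lemma effective_mass_homogenized:
  assumes "ground (\<lambda>v. 1 + Q v) \<psi> \<mu>" "homogenized \<psi> M"
  shows "effective_mass (lambda1 src tgt actv V0 Q) (matrix_inv M)"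
  using homogenized_expansion[OF assms] invertible_of_quad_pos[OF homogenized_pos[OF assms]]
  unfolding effective_mass_def lambda1_eq_bottom[abs_def] by blast

text \<open>Inversion keeps the constant and moves \<open>M'\<close> to the smaller side.\<close>

lemma mass_compare:
  assumes g: "ground q \<psi> \<mu>" "ground q' \<psi>' \<mu>'" "a > 0" "b > 0"
    and "\<And>v. v \<in> V0 \<Longrightarrow> a * \<psi>' v \<le> \<psi> v" "\<And>v. v \<in> V0 \<Longrightarrow> \<psi> v \<le> b * \<psi>' v"
    and M: "homogenized \<psi> M" "homogenized \<psi>' M'"
  shows "x \<bullet> (matrix_inv M' *v x) \<le> (b / a)\<^sup>2 * (x \<bullet> (matrix_inv M *v x))"
proof (rule quad_inverse_antimono)
  show "quad M x \<le> (b / a)\<^sup>2 * quad M' x" for x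
    using homogenized_compare[OF g(1-3) assms(5,6) M, of x] g(3) by (simp add: power_divide field_simps)
qed (use assms homogenized_pos in \<open>auto simp: homogenized_def\<close>)

end

section \<open>Assembly of simplicity, band estimate and mass estimate\<close>

theorem theorem2p1:
  fixes src tgt :: "'a \<Rightarrow> 'v" and rv :: "'a \<Rightarrow> 'a"
    and actv :: "int^'d \<Rightarrow> 'v \<Rightarrow> 'v" and acte :: "int^'d \<Rightarrow> 'a \<Rightarrow> 'a"
    and V0 :: "'v set" and Q :: "'v \<Rightarrow> real"
  assumes "CARD('d) \<ge> 2"
    and "periodic_graph src tgt rv actv acte"
    and "tree_representatives src tgt actv V0"
    and "\<forall>m v. Q (actv m v) = Q v"
  shows "\<exists>\<psi> :: 'v \<Rightarrow> real.
     \<comment> \<open>(i)\<close>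
     is_eigenvector src tgt actv V0 Q 0 (lambda1 src tgt actv V0 Q 0) (\<lambda>v. complex_of_real (\<psi> v)) \<and>
     (\<forall>v\<in>V0. \<psi> v > 0) \<and>
     (\<forall>f. is_eigenvector src tgt actv V0 Q 0 (lambda1 src tgt actv V0 Q 0) f \<longrightarrow>
          (\<exists>c::complex. \<forall>v. f v = c * complex_of_real (\<psi> v))) \<and>
     (let \<psi>m = Min ((\<lambda>v. \<psi> v / sqrt (degree src v)) ` V0);
          \<psi>p = Max ((\<lambda>v. \<psi> v / sqrt (degree src v)) ` V0);
          c0 = \<psi>p / \<psi>m;
          \<sigma>H = band1 src tgt actv V0 Q;
          \<sigma>\<Delta> = band1 src tgt actv V0 (\<lambda>_. 0)
      in
        \<comment> \<open>(ii)\<close>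
        Inf \<sigma>H < Sup \<sigma>H \<and>
        c0 powi (-2) * band_length \<sigma>\<Delta> \<le> band_length \<sigma>H \<and>
        band_length \<sigma>H \<le> c0\<^sup>2 * band_length \<sigma>\<Delta> \<and>
        \<comment> \<open>(iii)\<close>
        (\<exists>m m0. effective_mass (lambda1 src tgt actv V0 Q) m \<and>
                effective_mass (lambda1 src tgt actv V0 (\<lambda>_. 0)) m0 \<and>
                qf_le (c0 powi (-2) *\<^sub>R m0) m \<and> qf_le m (c0\<^sup>2 *\<^sub>R m0)))"
proof -
  interpret periodic_graph_fiber src tgt rv actv acte V0
    by unfold_locales (use assms in auto)
  define \<mu> where "\<mu> = lambda1 src tgt actv V0 Q 0"
  obtain \<psi> where g: "ground (\<lambda>v. 1 + Q v) \<psi> \<mu>" and out: "\<And>v. v \<notin> V0 \<Longrightarrow> \<psi> v = 0"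
    using ex_ground[of "\<lambda>v. 1 + Q v"] unfolding \<mu>_def lambda1_eq_bottom phase_0 by blast
  let ?r = "\<lambda>v. \<psi> v / sqrt (degree src v)"
  \<comment> \<open>Since \<open>sqrt (degree src v)\<close> is the ground state of the Laplacian,
    \<open>a\<close> and \<open>b\<close> are the extreme ratios of the two ground states.\<close>
  define a where "a = Min (?r ` V0)"
  define b where "b = Max (?r ` V0)"
  define c0 where "c0 = b / a"
  have psi_pos: "\<psi> v > 0" if "v \<in> V0" for v using g that by (simp add: ground_def)
  have a: "a > 0" unfolding a_def using finite_V0 V_nonempty by (auto simp: psi_pos degree_pos)
  have "a \<le> b" unfolding a_def b_def using finite_V0 V_nonempty by (meson Min_le Max_ge all_not_in_conv finite_imageI image_is_empty order_trans)
  then have b: "b > 0" using a by simp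
  have lo: "a * sqrt (degree src v) \<le> \<psi> v" if "v \<in> V0" for v
  proof -
    have "a \<le> ?r v" unfolding a_def using that finite_V0 by simp
    then show ?thesis using degree_pos[of v] by (simp add: field_simps)
  qed
  have hi: "\<psi> v \<le> b * sqrt (degree src v)" if "v \<in> V0" for v
  proof -
    have "?r v \<le> b" unfolding b_def using that finite_V0 by simp
    then show ?thesis using degree_pos[of v] by (simp add: field_simps)
  qed
  \<comment> \<open>With the two operators exchanged, \<open>a\<close> and \<open>b\<close> become
    \<open>1 / b\<close> and \<open>1 / a\<close>, whose ratio is again \<open>c0\<close>; this
    gives the lower band estimate and the upper mass estimate.\<close>
  have lo': "(1 / b) * \<psi> v \<le> sqrt (degree src v)" if "v \<in> V0" for v
    using hi[OF that] b by (simp add: field_simps)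
  have hi': "sqrt (degree src v) \<le> (1 / a) * \<psi> v" if "v \<in> V0" for v
    using lo[OF that] a by (simp add: field_simps)
  have c0: "c0 > 0" using a b by (simp add: c0_def)
  have c0': "(1 / a) / (1 / b) = c0" by (simp add: c0_def)
  have inv: "c0 powi (-2) = 1 / c0\<^sup>2" by (simp add: power_int_minus field_simps)
  obtain M where M: "homogenized \<psi> M" using ex_homogenized[OF g] by blast
  obtain M0 where M0: "homogenized (\<lambda>v. sqrt (degree src v)) M0"
    using ex_homogenized[OF laplacian_ground] by blast
  have "band_length (band1 src tgt actv V0 (\<lambda>_. 0)) \<le> c0\<^sup>2 * band_length (band1 src tgt actv V0 Q)"
    using band_length_compare[OF laplacian_ground g _ lo' hi'] a b unfolding c0' by simp
  then have band_lower: "c0 powi (-2) * band_length (band1 src tgt actv V0 (\<lambda>_. 0)) \<le> band_length (band1 src tgt actv V0 Q)"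
    using c0 unfolding inv by (simp add: field_simps)
  have band_upper: "band_length (band1 src tgt actv V0 Q) \<le> c0\<^sup>2 * band_length (band1 src tgt actv V0 (\<lambda>_. 0))"
    using band_length_compare[OF g laplacian_ground a lo hi] unfolding c0_def .
  have "x \<bullet> (matrix_inv M0 *v x) \<le> c0\<^sup>2 * (x \<bullet> (matrix_inv M *v x))" for x
    using mass_compare[OF g laplacian_ground a b lo hi M M0] unfolding c0_def .
  then have "qf_le (c0 powi (-2) *\<^sub>R matrix_inv M0) (matrix_inv M)"
    unfolding qf_le_def inv using c0 by (simp add: scaleR_matrix_vector_assoc[symmetric] field_simps)
  moreover have "x \<bullet> (matrix_inv M *v x) \<le> c0\<^sup>2 * (x \<bullet> (matrix_inv M0 *v x))" for x
    using mass_compare[OF laplacian_ground g _ _ lo' hi' M0 M] a b unfolding c0' by simp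
  then have "qf_le (matrix_inv M) (c0\<^sup>2 *\<^sub>R matrix_inv M0)"
    unfolding qf_le_def by (simp add: scaleR_matrix_vector_assoc[symmetric])
  ultimately have mass: "\<exists>m m0. effective_mass (lambda1 src tgt actv V0 Q) m \<and>
      effective_mass (lambda1 src tgt actv V0 (\<lambda>_. 0)) m0 \<and>
      qf_le (c0 powi (-2) *\<^sub>R m0) m \<and> qf_le m (c0\<^sup>2 *\<^sub>R m0)"
    using effective_mass_homogenized[OF g M] effective_mass_homogenized[OF laplacian_ground M0] by blast
  have nondeg: "Inf (band1 src tgt actv V0 Q) < Sup (band1 src tgt actv V0 Q)"
    using band_nondegenerate[OF g] Inf_band[OF g] by simp
  have eig: "is_eigenvector src tgt actv V0 Q 0 \<mu> (\<lambda>v. complex_of_real (\<psi> v))"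
    unfolding is_eigenvector_iff phase_0 using out by (intro ground_eigenvec[OF g]) (simp add: fvec_def)
  have simple: "\<exists>c. \<forall>v. f v = c * complex_of_real (\<psi> v)" if f: "is_eigenvector src tgt actv V0 Q 0 \<mu> f" for f
  proof -
    obtain c where c: "\<forall>v\<in>V0. f v = c * complex_of_real (\<psi> v)"
      using ground_simple[OF g] f unfolding is_eigenvector_iff phase_0 by blast
    have "f v = c * complex_of_real (\<psi> v)" for v
      using c f out[of v] by (cases "v \<in> V0") (auto simp: is_eigenvector_def fvec_def)
    then show ?thesis by blast
  qed
  show ?thesis
    by (rule exI[of _ \<psi>])
      (use eig psi_pos simple nondeg band_lower band_upper mass in
        \<open>simp add: Let_def \<mu>_def[symmetric] a_def[symmetric] b_def[symmetric] c0_def[symmetric]\<close>)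
qed

end
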